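(* Let $k,d\in\mathbb N_0$ and let $G$ be a graph (parallel edges allowed, no loops) with $\Gamma_f(G)\le k+\frac{d}{d+k+1}$. (i) If $d\le k+1$, then $E(G)$ can be partitioned into $k+1$ forests such that in one of these forests every connected component has at most $d$ edges. (ii) If $k+1<d\le 2(k+1)$, then $E(G)$ can be partitioned into $k+1$ forests such that in one of these forests every connected component has at most $d+\left\lceil k\cdot\frac{d}{k+1}\right\rceil-k$ edges.
   Context: For a graph $H$ write $e(H)=|E(H)|$ and $v(H)=|V(H)|$. The fractional arboricity of $G$ is $\Gamma_f(G)=\max\{\frac{e(H)}{v(H)-1} : H\subseteq G,\ v(H)\ge 2\}$. A decomposition (partition) of $G$ into forests is a partition of $E(G)$ into edge sets each inducing an acyclic graph. *)

theory Defs
  imports Complex_Main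
begin

text \<open>
  Finite undirected graphs with parallel edges: edges are abstract objects, and \<open>ends G e\<close> is
  the set of endpoints of the edge \<open>e\<close>.
\<close>

record ('v, 'e) multigraph =
  verts :: "'v set"
  edges :: "'e set"
  ends :: "'e \<Rightarrow> 'v set"

locale loopfree_multigraph =
  fixes G :: "('v, 'e) multigraph"
  assumes finite_verts: "finite (verts G)"
    and finite_edges: "finite (edges G)"
    and ends_subset: "e \<in> edges G \<Longrightarrow> ends G e \<subseteq> verts G"
    and no_loops: "e \<in> edges G \<Longrightarrow> card (ends G e) = 2"

definition subgraph :: "('v, 'e) multigraph \<Rightarrow> ('v, 'e) multigraph \<Rightarrow> bool" where
  "subgraph H G \<longleftrightarrow>
     loopfree_multigraph H \<and> verts H \<subseteq> verts G \<and> edges H \<subseteq> edges G \<and>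
     (\<forall>e\<in>edges H. ends H e = ends G e)"

definition arboricity_ratios :: "('v, 'e) multigraph \<Rightarrow> real set" where
  "arboricity_ratios G =
     {real (card (edges H)) / (real (card (verts H)) - 1) | H. subgraph H G \<and> card (verts H) \<ge> 2}"

text \<open>
  A graph with at most one vertex has no subgraph on two vertices; its fractional arboricity
  is taken to be \<open>0\<close>.
\<close>

definition fractional_arboricity :: "('v, 'e) multigraph \<Rightarrow> real" where
  "fractional_arboricity G =
     (if card (verts G) \<ge> 2 then Max (arboricity_ratios G) else 0)"

lemma finite_arboricity_ratios:
  assumes "loopfree_multigraph G"
  shows "finite (arboricity_ratios G)"
proof -
  interpret loopfree_multigraph G by fact
  have "arboricity_ratios G \<subseteq>
      (\<lambda>(F, W). real (card F) / (real (card W) - 1)) ` (Pow (edges G) \<times> Pow (verts G))"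
    unfolding arboricity_ratios_def subgraph_def by force
  then show ?thesis
    by (rule finite_subset) (simp add: finite_verts finite_edges)
qed

lemma arboricity_ratios_nonempty:
  assumes "loopfree_multigraph G" "card (verts G) \<ge> 2"
  shows "arboricity_ratios G \<noteq> {}"
  using assms unfolding arboricity_ratios_def subgraph_def by blast

text \<open>
  A cycle visits distinct vertices \<open>vs ! 0, \<dots>, vs ! (n - 1)\<close> along distinct edges, where
  \<open>es ! i\<close> joins \<open>vs ! i\<close> to its cyclic successor. Two parallel edges form a cycle with
  \<open>n = 2\<close>; \<open>n = 1\<close> would be a loop.
\<close>

definition is_cycle :: "('v, 'e) multigraph \<Rightarrow> 'v list \<Rightarrow> 'e list \<Rightarrow> bool" where
  "is_cycle G vs es \<longleftrightarrow>
     vs \<noteq> [] \<and> length es = length vs \<and> distinct vs \<and> distinct es \<and>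
     set vs \<subseteq> verts G \<and> set es \<subseteq> edges G \<and>
     (\<forall>i<length es. ends G (es ! i) = {vs ! i, vs ! (Suc i mod length vs)})"

definition acyclic_graph :: "('v, 'e) multigraph \<Rightarrow> bool" where
  "acyclic_graph G \<longleftrightarrow> (\<nexists>vs es. is_cycle G vs es)"

definition edge_induced :: "('v, 'e) multigraph \<Rightarrow> 'e set \<Rightarrow> ('v, 'e) multigraph" where
  "edge_induced G F = \<lparr>verts = (\<Union>e\<in>F. ends G e), edges = F, ends = ends G\<rparr>"

definition adjacency :: "('v, 'e) multigraph \<Rightarrow> ('v \<times> 'v) set" where
  "adjacency G = {(u, v). \<exists>e\<in>edges G. ends G e = {u, v}}"

definition component_of :: "('v, 'e) multigraph \<Rightarrow> 'v \<Rightarrow> ('v, 'e) multigraph" where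
  "component_of G v =
     (let C = {w \<in> verts G. (v, w) \<in> (adjacency G)\<^sup>*}
      in \<lparr>verts = C, edges = {e \<in> edges G. ends G e \<subseteq> C}, ends = ends G\<rparr>)"

definition components :: "('v, 'e) multigraph \<Rightarrow> ('v, 'e) multigraph set" where
  "components G = component_of G ` verts G"

text \<open>
  Partition of the edge set into \<open>n\<close> forests \<open>F 0, \<dots>, F (n - 1)\<close>; some of them may be empty.
\<close>

definition forest_partition :: "('v, 'e) multigraph \<Rightarrow> nat \<Rightarrow> (nat \<Rightarrow> 'e set) \<Rightarrow> bool" where
  "forest_partition G n F \<longleftrightarrow>
     (\<Union>i<n. F i) = edges G \<and>
     (\<forall>i<n. \<forall>j<n. i \<noteq> j \<longrightarrow> F i \<inter> F j = {}) \<and>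
     (\<forall>i<n. acyclic_graph (edge_induced G (F i)))"

end

theory Submission
  imports Defs
begin

text \<open>
  Among the partitions of the edges into \<open>k + 1\<close> forests, choose one in which the last, red, forest
  has as few edges as possible. By the augmenting argument of Nash-Williams the other \<open>k\<close> forests
  then span every class of an equivalence relation that contains all red edges, so it suffices to
  treat decompositions into \<open>k\<close> spanning forests and a red forest. Among these minimise first the
  size \<open>M\<close> of the largest red component and then the number of vertices in components of size
  \<open>M\<close>. From a root \<open>r\<close> in such a component, list the red components that can be reached by following
  the spanning trees towards \<open>r\<close>, and choose the list of their sizes lexicographically minimal.

  If a red component has a small successor in this list, add the connecting arc to the red forest;
  repairing the spanning tree that has lost the arc by a chain of exchanges finally removes a red
  edge from a component that is not later in the list, against the minimality. So a component and its
  successor together have at least \<open>M\<close> vertices, and similarly no two successors in one tree are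
  single vertices and no three have at most two vertices each. If \<open>M\<close> exceeded the claimed bound,
  charging each small component to its predecessor would show that the subgraph spanned by the
  listed components is too dense.
\<close>

section \<open>Connectivity and forests\<close>

text \<open>Let \<open>L\<close> listed components cover \<open>R\<close> vertices. The
  \<open>k\<close> trees have at least \<open>k * (R - 1)\<close> edges on them and the red forest
  \<open>R - L\<close>, so the arboricity bound leaves at most \<open>(L - 1) * d / (k + 1)\<close>
  red edges. Give a component with \<open>m\<close> edges the weight \<open>(k + 1) * m - d\<close>;
  negative weights must then outbalance the others, and the contradiction comes from letting
  predecessors pay for them. For \<open>d \<le> k + 1\<close> only single vertices have negative
  weight, for \<open>d \<le> 2 * (k + 1)\<close> only components with at most one edge. This is the
  reason for the range of \<open>d\<close>: to limit the small successors in one tree, two or three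
  arcs are added at once, and their tails must be separated by red edges that the tree can absorb
  without a cycle. In (ii) one tree can charge a predecessor with at most one single vertex, costing
  \<open>d\<close>, and one single edge, costing \<open>d - k - 1\<close>. If some component has
  more than \<open>D\<close> edges, the predecessor of a single vertex still has at least
  \<open>D\<close> edges, and it can pay if
  \<open>k * (2 * d - k - 1) \<le> (k + 1) * D - d\<close>. Solving for \<open>D\<close> gives the
  bound \<open>d + k * d / (k + 1) - k\<close>.\<close>

locale edge_ends =
  fixes en :: "'e \<Rightarrow> 'v set"
begin

definition conn :: "'e set \<Rightarrow> 'v \<Rightarrow> 'v \<Rightarrow> bool" where
  "conn S = (\<lambda>u v. \<exists>e\<in>S. en e = {u, v})\<^sup>*\<^sup>*"

definition comp :: "'e set \<Rightarrow> 'v \<Rightarrow> 'v set" where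
  "comp S v = {w. conn S v w}"

text \<open>Acyclicity is encoded as every edge being a bridge; as \<open>conn\<close> is reflexive,
  this excludes loops too. Cycles as vertex and edge lists occur only in
  \<open>forest_acyclic\<close>.\<close>

definition forest :: "'e set \<Rightarrow> bool" where
  "forest S \<longleftrightarrow> finite S \<and> (\<forall>e\<in>S. \<exists>u v. en e = {u, v} \<and> \<not> conn (S - {e}) u v)"

lemma conn_refl [simp]: "conn S u u"
  by (simp add: conn_def)

lemma conn_sym: "conn S u v \<Longrightarrow> conn S v u"
proof -
  have "symp (\<lambda>u v. \<exists>e\<in>S. en e = {u, v})"
    by (auto simp: symp_def insert_commute)
  from symp_rtranclp[OF this] show "conn S u v \<Longrightarrow> conn S v u"
    unfolding conn_def by (rule sympD)
qed

lemma conn_commute: "conn S u v \<longleftrightarrow> conn S v u"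
  using conn_sym by blast

lemma conn_trans [trans]: "conn S u v \<Longrightarrow> conn S v w \<Longrightarrow> conn S u w"
  unfolding conn_def by (rule rtranclp_trans)

lemma conn_edge: "e \<in> S \<Longrightarrow> en e = {u, v} \<Longrightarrow> conn S u v"
  unfolding conn_def by (rule r_into_rtranclp) blast

lemma equivp_conn: "equivp (conn S)"
  by (rule equivpI) (auto simp: reflp_def symp_def transp_def intro: conn_sym conn_trans)

lemma conn_least:
  assumes "conn S a b" "equivp Q" "\<And>e u v. e \<in> S \<Longrightarrow> en e = {u, v} \<Longrightarrow> Q u v"
  shows "Q a b"
  using assms(1) unfolding conn_def
proof (induction rule: rtranclp_induct)
  case base
  then show ?case using assms(2) by (simp add: equivp_reflp)
next
  case (step y z)
  then show ?case using assms(2,3) by (metis equivp_transp)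
qed

lemma conn_le:
  assumes "conn S a b" "\<And>e u v. e \<in> S \<Longrightarrow> en e = {u, v} \<Longrightarrow> conn S' u v"
  shows "conn S' a b"
  using conn_least[OF assms(1) equivp_conn] assms(2) by blast

lemma conn_mono: "conn S u v \<Longrightarrow> S \<subseteq> S' \<Longrightarrow> conn S' u v"
  by (erule conn_le) (auto intro: conn_edge)

lemma conn_invariant:
  assumes "conn S a b" "a \<in> W" "\<And>e u v. e \<in> S \<Longrightarrow> en e = {u, v} \<Longrightarrow> u \<in> W \<Longrightarrow> v \<in> W"
  shows "b \<in> W"
  using assms(1) unfolding conn_def
  by (induction rule: rtranclp_induct) (use assms(2,3) in blast)+

lemma conn_cross:
  assumes "conn S a b" "a \<in> P" "b \<notin> P"
  obtains e u v where "e \<in> S" "en e = {u, v}" "u \<in> P" "v \<notin> P"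
  using conn_invariant[OF assms(1,2)] assms(3) by blast

lemma conn_insert_split:
  assumes "conn (insert e S) a b" "en e = {u, v}"
  shows "conn S a b \<or> conn S a u \<and> conn S v b \<or> conn S a v \<and> conn S u b"
  using assms(1) unfolding conn_def[of "insert e S"]
proof (induction rule: rtranclp_induct)
  case base
  then show ?case by simp
next
  case (step y z)
  then obtain e' where e': "e' \<in> insert e S" "en e' = {y, z}" by blast
  show ?case
  proof (cases "e' \<in> S")
    case True
    then have "conn S y z" using e'(2) conn_edge by blast
    with step.IH show ?thesis by (meson conn_trans)
  next
    case False
    then have "y = u \<and> z = v \<or> y = v \<and> z = u"
      using e' assms(2) by (auto simp: doubleton_eq_iff)
    with step.IH show ?thesis by (meson conn_refl conn_sym conn_trans)
  qed
qed

lemma conn_remove_split: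
  assumes "conn S a b" "en e = {u, v}"
  shows "conn (S - {e}) a b \<or> conn (S - {e}) a u \<and> conn (S - {e}) v b
    \<or> conn (S - {e}) a v \<and> conn (S - {e}) u b"
proof -
  have "conn (insert e (S - {e})) a b" using assms(1) by (rule conn_mono) blast
  then show ?thesis using assms(2) by (rule conn_insert_split)
qed

lemma conn_edge_removeE:
  assumes "conn S a b" "\<not> conn (S - {e}) a b" "e \<in> S" "card (en e) = 2"
  obtains u v where "en e = {u, v}" "conn (S - {e}) a u" "conn (S - {e}) v b"
proof -
  obtain u v where uv: "en e = {u, v}" using assms(4) by (meson card_2_iff)
  then have uv': "en e = {v, u}" by (simp add: insert_commute)
  show thesis
    using conn_remove_split[OF assms(1) uv] assms(2) that[OF uv] that[OF uv'] by blast
qed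

lemma forest_finite: "forest S \<Longrightarrow> finite S"
  by (simp add: forest_def)

lemma forest_bridge:
  assumes "forest S" "e \<in> S" "en e = {u, v}"
  shows "\<not> conn (S - {e}) u v"
proof -
  obtain p q where "en e = {p, q}" "\<not> conn (S - {e}) p q"
    using assms unfolding forest_def by blast
  with assms(3) show ?thesis by (auto simp: doubleton_eq_iff conn_commute)
qed

lemma forest_endsE:
  assumes "forest S" "e \<in> S"
  obtains u v where "en e = {u, v}" "u \<noteq> v" "\<not> conn (S - {e}) u v"
  using assms unfolding forest_def by (metis conn_refl)

lemma forest_card_ends: "forest S \<Longrightarrow> e \<in> S \<Longrightarrow> card (en e) = 2"
  by (metis forest_endsE card_2_iff)

lemma forest_empty [simp]: "forest {}"
  by (simp add: forest_def)

lemma forest_subset: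
  assumes "forest S" "S' \<subseteq> S"
  shows "forest S'"
  unfolding forest_def
proof (intro conjI ballI)
  show "finite S'" using assms forest_finite finite_subset by blast
  fix e assume "e \<in> S'"
  then obtain u v where uv: "en e = {u, v}" "\<not> conn (S - {e}) u v"
    using assms by (metis forest_endsE subsetD)
  then have "\<not> conn (S' - {e}) u v" using conn_mono[of "S' - {e}" u v "S - {e}"] assms(2) by blast
  with uv show "\<exists>u v. en e = {u, v} \<and> \<not> conn (S' - {e}) u v" by blast
qed

lemma forest_insert:
  assumes "forest S" "en e = {u, v}" "\<not> conn S u v"
  shows "forest (insert e S)"
  unfolding forest_def
proof (intro conjI ballI)
  show "finite (insert e S)" using assms(1) forest_finite by simp
  fix f assume f: "f \<in> insert e S"
  show "\<exists>p q. en f = {p, q} \<and> \<not> conn (insert e S - {f}) p q"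
  proof (cases "f = e")
    case True
    have "insert e S - {e} \<subseteq> S" by blast
    then have "\<not> conn (insert e S - {e}) u v" using assms(3) conn_mono by blast
    with True assms(2) show ?thesis by blast
  next
    case False
    then have fS: "f \<in> S" and eq: "insert e S - {f} = insert e (S - {f})" using f by auto
    obtain p q where pq: "en f = {p, q}" "\<not> conn (S - {f}) p q"
      using forest_endsE[OF assms(1) fS] by blast
    have mono: "conn S x y" if "conn (S - {f}) x y" for x y using that by (rule conn_mono) blast
    have "conn S p q" using fS pq(1) by (rule conn_edge)
    then have "\<not> conn (insert e (S - {f})) p q"
      using conn_insert_split[OF _ assms(2), of "S - {f}" p q] pq(2) assms(3) mono
      by (meson conn_sym conn_trans)
    with pq(1) eq show ?thesis by metis
  qed
qed

lemma forest_insertD: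
  assumes "forest (insert e S)" "e \<notin> S" "en e = {u, v}"
  shows "\<not> conn S u v"
  using forest_bridge[OF assms(1) _ assms(3)] assms(2) by simp

text \<open>Deleting \<open>y\<close> cuts \<open>P\<close> into a part at \<open>a\<close> and a
  part at \<open>b\<close>; a connection of \<open>a\<close> and \<open>b\<close> in
  \<open>S\<close> avoiding \<open>y\<close> would join the two ends of the bridge
  \<open>y\<close>.\<close>

lemma forest_bridge_mono:
  assumes "forest S" "P \<subseteq> S" "conn P a b" "\<not> conn (P - {y}) a b" "y \<in> P"
  shows "\<not> conn (S - {y}) a b"
proof
  assume c: "conn (S - {y}) a b"
  have y: "card (en y) = 2" using assms(1,2,5) forest_card_ends by blast
  obtain p q where pq: "en y = {p, q}" "conn (P - {y}) a p" "conn (P - {y}) q b"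
    using conn_edge_removeE[OF assms(3,4,5) y] .
  have "P - {y} \<subseteq> S - {y}" using assms(2) by blast
  then have "conn (S - {y}) a p" "conn (S - {y}) q b" using pq conn_mono by blast+
  then have "conn (S - {y}) p q" using c by (meson conn_sym conn_trans)
  with forest_bridge[OF assms(1) _ pq(1)] assms(2,5) show False by blast
qed

text \<open>In a forest the edges separating \<open>a\<close> from \<open>b\<close> form the path
  between them, so paths can be handled as edge sets. An inclusion-minimal connecting set consists
  of such edges only.\<close>

lemma conn_bridges:
  assumes "forest S" "conn S a b"
  shows "conn {y \<in> S. \<not> conn (S - {y}) a b} a b"
proof -
  let ?\<P> = "{P. P \<subseteq> S \<and> conn P a b}"
  have "finite ?\<P>" using assms(1) forest_finite by simp
  moreover have "S \<in> ?\<P>" using assms(2) by simp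
  ultimately obtain P where "P \<in> ?\<P>" and "\<forall>P'\<in>?\<P>. P' \<subseteq> P \<longrightarrow> P = P'"
    using finite_has_minimal2[of ?\<P> S] by blast
  then have P: "P \<subseteq> S" "conn P a b"
    and min: "\<And>P'. P' \<subseteq> S \<Longrightarrow> conn P' a b \<Longrightarrow> P' \<subseteq> P \<Longrightarrow> P' = P"
    by auto
  have "\<not> conn (P - {y}) a b" if "y \<in> P" for y
    using min[of "P - {y}"] P that by blast
  then have "P \<subseteq> {y \<in> S. \<not> conn (S - {y}) a b}"
    using forest_bridge_mono[OF assms(1) P] P(1) by blast
  with P(2) show ?thesis using conn_mono by blast
qed

text \<open>The last hypothesis puts \<open>y\<close> on the path of \<open>S\<close> between the
  ends of \<open>x\<close>; after the swap the ends of \<open>y\<close> are joined the other way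
  round, through \<open>x\<close>.\<close>

lemma exchange:
  assumes "forest S" "y \<in> S" "en x = {u, v}" "conn S u v" "\<not> conn (S - {y}) u v"
  shows "forest (insert x (S - {y}))" "conn (insert x (S - {y})) = conn S"
proof -
  show "forest (insert x (S - {y}))"
    using forest_insert[OF forest_subset[OF assms(1)] assms(3,5)] by blast
  obtain p q where pq: "en y = {p, q}" "conn (S - {y}) u p" "conn (S - {y}) q v"
    using conn_edge_removeE[OF assms(4,5,2) forest_card_ends[OF assms(1,2)]] .
  let ?S = "insert x (S - {y})"
  have "S - {y} \<subseteq> ?S" by blast
  then have "conn ?S u p" "conn ?S q v" "conn ?S u v"
    using pq conn_mono conn_edge[of x ?S] assms(3) by blast+
  then have yc: "conn ?S p q" by (meson conn_sym conn_trans)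
  show "conn ?S = conn S"
  proof (intro ext iffI)
    fix a b assume "conn ?S a b"
    then show "conn S a b"
    proof (rule conn_le)
      fix e s t assume "e \<in> ?S" and e: "en e = {s, t}"
      then consider "e = x" | "e \<in> S" by blast
      then show "conn S s t"
      proof cases
        case 1
        with e assms(3,4) show ?thesis by (auto simp: doubleton_eq_iff conn_commute)
      next
        case 2
        then show ?thesis using e by (rule conn_edge)
      qed
    qed
  next
    fix a b assume "conn S a b"
    then show "conn ?S a b"
    proof (rule conn_le)
      fix e s t assume "e \<in> S" and e: "en e = {s, t}"
      then consider "e = y" | "e \<in> ?S" by blast
      then show "conn ?S s t"
      proof cases
        case 1
        with e pq(1) yc show ?thesis by (auto simp: doubleton_eq_iff conn_commute)
      next
        case 2
        then show ?thesis using e by (rule conn_edge)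
      qed
    qed
  qed
qed

lemma conn_Un_cong:
  assumes "conn X = conn X'"
  shows "conn (X \<union> Y) = conn (X' \<union> Y)"
proof -
  have *: "conn (X' \<union> Y) a b" if "conn (X \<union> Y) a b" "conn X = conn X'" for a b X X'
    using that(1)
  proof (rule conn_le)
    fix e u v assume "e \<in> X \<union> Y" and e: "en e = {u, v}"
    then consider "e \<in> X" | "e \<in> Y" by blast
    then show "conn (X' \<union> Y) u v"
    proof cases
      case 1
      then have "conn X' u v" using e that(2) conn_edge by metis
      then show ?thesis by (rule conn_mono) blast
    next
      case 2
      then show ?thesis using e by (intro conn_edge) auto
    qed
  qed
  show ?thesis using *[OF _ assms] *[OF _ assms[symmetric]] by (intro ext) blast
qed

text \<open>Whether an edge closes a cycle depends only on the connectivity of what is present. In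
  \<open>decomposition\<close> this puts changed trees back next to the edges outside
  \<open>E'\<close>.\<close>

lemma forest_Un_cong:
  assumes "forest X'" "conn X = conn X'" "finite Y" "forest (X \<union> Y)" "X \<inter> Y = {}"
  shows "forest (X' \<union> Y)"
  using assms(3-5)
proof (induction Y rule: finite_induct)
  case empty
  then show ?case using assms(1) by simp
next
  case (insert y Y)
  have "forest (X \<union> Y)" using insert.prems(1) by (rule forest_subset) blast
  then have fo: "forest (X' \<union> Y)" using insert by blast
  have y: "forest (insert y (X \<union> Y))" "y \<notin> X \<union> Y" using insert by auto
  obtain u v where uv: "en y = {u, v}" using forest_endsE[OF y(1)] by blast
  then have "\<not> conn (X \<union> Y) u v" using forest_insertD[OF y] by blast
  then have "\<not> conn (X' \<union> Y) u v" using conn_Un_cong[OF assms(2)] by metis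
  then show ?case using forest_insert[OF fo uv] by simp
qed

text \<open>Matroid exchange: each edge of \<open>S - T\<close> is swapped into \<open>T\<close>
  against an edge outside \<open>S\<close>, which preserves the size and the classes of
  \<open>T\<close>.\<close>

lemma forest_card_le:
  assumes "forest S" "forest T" "\<And>u v. conn S u v \<Longrightarrow> conn T u v"
  shows "card S \<le> card T"
  using assms(2,3)
proof (induction "card (S - T)" arbitrary: T)
  case 0
  then have "S \<subseteq> T" using assms(1) forest_finite by auto
  then show ?case using 0 forest_finite card_mono by blast
next
  case (Suc n)
  then obtain s where s: "s \<in> S" "s \<notin> T" by (metis Diff_iff card.empty ex_in_conv nat.distinct(1))
  obtain u v where uv: "en s = {u, v}" "\<not> conn (S - {s}) u v"
    using forest_endsE[OF assms(1) s(1)] by blast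
  have cT: "conn T u v" using Suc.prems(2) s(1) uv(1) conn_edge by blast
  \<comment> \<open>The path of \<open>T\<close> between the ends of \<open>s\<close> cannot lie
    inside \<open>S - {s}\<close>, so it contains an edge outside \<open>S\<close>.\<close>
  obtain t where t: "t \<in> T" "\<not> conn (T - {t}) u v" "t \<notin> S"
  proof (rule ccontr)
    assume "\<not> thesis"
    then have "{y \<in> T. \<not> conn (T - {y}) u v} \<subseteq> S - {s}" using that s(2) by blast
    then show False using conn_bridges[OF Suc.prems(1) cT] uv(2) conn_mono by blast
  qed
  let ?T = "insert s (T - {t})"
  have ex: "forest ?T" "conn ?T = conn T" using exchange[OF Suc.prems(1) t(1) uv(1) cT t(2)] .
  have "S - ?T = (S - T) - {s}" using t(3) by blast
  then have "n = card (S - ?T)"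
    using Suc.hyps(2) s assms(1) forest_finite by (simp add: card_Diff_singleton)
  then have "card S \<le> card ?T" using Suc.hyps(1) ex Suc.prems(2) by metis
  also have "card ?T = card T"
    using s(2) t(1) Suc.prems(1) forest_finite by (metis card.remove card_insert_disjoint finite_Diff
      Diff_iff)
  finally show ?case .
qed

text \<open>An edge of \<open>T\<close> between two classes of \<open>S\<close> could be added to
  \<open>S\<close>, against \<open>forest_card_le\<close>. Thus spanning can be verified by counting
  edges.\<close>

lemma forest_spanning:
  assumes "forest S" "forest T" "\<And>u v. conn S u v \<Longrightarrow> conn T u v" "card S = card T"
  shows "conn S = conn T"
proof (intro ext iffI)
  fix a b assume "conn T a b"
  then show "conn S a b"
  proof (rule conn_le)
    fix e u v assume eT: "e \<in> T" "en e = {u, v}"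
    show "conn S u v"
    proof (rule ccontr)
      assume "\<not> conn S u v"
      note e = eT this
      have eS: "e \<notin> S" using e conn_edge by blast
      have "conn T x y" if "conn (insert e S) x y" for x y
        using that
      proof (rule conn_le)
        fix e' s t assume "e' \<in> insert e S" "en e' = {s, t}"
        then show "conn T s t" using e(1) assms(3) conn_edge by blast
      qed
      then have "card (insert e S) \<le> card T"
        using forest_card_le[OF forest_insert[OF assms(1) e(2,3)] assms(2)] by blast
      then show False using eS assms(1,4) forest_finite by simp
    qed
  qed
qed (use assms(3) in blast)

subsection \<open>Orienting forests towards a root\<close>

text \<open>In a forest, \<open>e\<close> is the edge with which \<open>x\<close> starts its path to
  \<open>r\<close>. The formulation by deletion avoids paths.\<close>

definition arc :: "'e set \<Rightarrow> 'v \<Rightarrow> 'v \<Rightarrow> 'e \<Rightarrow> 'v \<Rightarrow> bool" where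
  "arc T r x e y \<longleftrightarrow> e \<in> T \<and> en e = {x, y} \<and> conn (T - {e}) y r"

lemma arc_tail_cut:
  assumes "forest T" "arc T r x e y"
  shows "\<not> conn (T - {e}) x r"
  using forest_bridge[OF assms(1), of e x y] assms(2) unfolding arc_def
  by (meson conn_sym conn_trans)

lemma arc_exists:
  assumes "forest T" "conn T x r" "x \<noteq> r"
  obtains e y where "arc T r x e y"
proof -
  let ?P = "{y \<in> T. \<not> conn (T - {y}) x r}"
  have "conn ?P x r" using conn_bridges[OF assms(1,2)] .
  then have "x = r \<or> (\<exists>y. \<exists>e\<in>?P. en e = {x, y})"
    unfolding conn_def by (rule converse_rtranclpE) blast+
  then obtain e y where e: "e \<in> ?P" "en e = {x, y}" using assms(3) by blast
  have "conn (T - {e}) y r"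
    using conn_remove_split[OF assms(2) e(2)] e(1) by blast
  then show thesis using that e unfolding arc_def by blast
qed

lemma edge_arc:
  assumes "e \<in> T" "en e = {u, v}" "conn T u r"
  shows "arc T r u e v \<or> arc T r v e u"
  using conn_remove_split[OF assms(3,2)] assms(1,2) unfolding arc_def
  by (auto simp: insert_commute)

lemma arc_edge_unique:
  assumes "forest T" "arc T r x e y" "arc T r x e' y'"
  shows "e = e'"
proof (rule ccontr)
  assume ne: "e \<noteq> e'"
  have e: "e \<in> T" "en e = {x, y}" "conn (T - {e}) y r"
    and e': "e' \<in> T" "en e' = {x, y'}" "conn (T - {e'}) y' r"
    using assms unfolding arc_def by auto
  have xr: "\<not> conn (T - {e}) x r" using arc_tail_cut assms by blast
  have "conn (T - {e}) x y'" using e' ne by (intro conn_edge) auto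
  then have y'r: "\<not> conn (T - {e}) y' r" using xr conn_trans by blast
  let ?S = "T - {e'} - {e}"
  have m: "conn (T - {e}) a b" "conn (T - {e'}) a b" if "conn ?S a b" for a b
    using that by (auto elim!: conn_mono)
  have "\<not> conn (T - {e'}) y' x" using forest_bridge[OF assms(1) e'(1,2)] conn_sym by blast
  then show False
    using conn_remove_split[OF e'(3) e(2)] m xr y'r by blast
qed

lemma arc_orient:
  assumes "forest T" "arc T r x e y" "arc T r x' e y'"
  shows "x = x'" "y = y'"
proof -
  have "\<not> conn (T - {e}) x r" using arc_tail_cut assms(1,2) .
  moreover have "en e = {x, y}" "en e = {x', y'}" "conn (T - {e}) y' r"
    using assms(2,3) unfolding arc_def by auto
  ultimately show "x = x'" "y = y'" by (auto simp: doubleton_eq_iff)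
qed

lemma arc_conn: "arc T r x e y \<Longrightarrow> conn T x r \<and> conn T y r"
proof
  assume a: "arc T r x e y"
  then show yr: "conn T y r" unfolding arc_def by (auto elim: conn_mono)
  have "conn T x y" using a unfolding arc_def by (auto intro: conn_edge)
  then show "conn T x r" using yr conn_trans by blast
qed

text \<open>If \<open>x\<close> still reaches \<open>r\<close> without \<open>A\<close>, it does so
  through its only outgoing arc, which therefore is not in \<open>A\<close>. So connection to the
  root tells which arcs of a damaged tree remain usable.\<close>

lemma arc_survives:
  assumes "forest T" "arc T r x e y" "conn (T - A) x r" "T - A \<subseteq> T'"
  shows "e \<notin> A" "conn (T - A) y r" "arc T' r x e y"
proof -
  have e: "e \<in> T" "en e = {x, y}" using assms(2) unfolding arc_def by auto
  have xr: "\<not> conn (T - {e}) x r" using arc_tail_cut assms by blast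
  show eA: "e \<notin> A"
  proof
    assume "e \<in> A"
    then have "T - A \<subseteq> T - {e}" by blast
    with assms(3) have "conn (T - {e}) x r" by (rule conn_mono)
    with xr show False ..
  qed
  have "T - A - {e} \<subseteq> T - {e}" by blast
  with xr have "\<not> conn (T - A - {e}) x r" using conn_mono by blast
  then have *: "conn (T - A - {e}) y r" using conn_remove_split[OF assms(3) e(2)] by blast
  then show "conn (T - A) y r" by (auto elim: conn_mono)
  have "conn (T' - {e}) y r" using * by (rule conn_mono) (use assms(4) in blast)
  then show "arc T' r x e y" using e eA assms(4) unfolding arc_def by blast
qed

section \<open>Components and their numbers of edges\<close>

lemma comp_subset:
  assumes "\<And>e. e \<in> S \<Longrightarrow> en e \<subseteq> V" "v \<in> V"
  shows "comp S v \<subseteq> V"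
proof
  fix w assume "w \<in> comp S v"
  then have "conn S v w" by (simp add: comp_def)
  then show "w \<in> V" using assms(2) by (rule conn_invariant) (use assms(1) in blast)
qed

lemma finite_comp:
  assumes "forest S"
  shows "finite (comp S v)"
proof -
  have "comp S v \<subseteq> insert v (\<Union>e\<in>S. en e)" by (rule comp_subset) auto
  moreover have "finite (insert v (\<Union>e\<in>S. en e))"
    using assms forest_finite forest_card_ends by (simp add: card_ge_0_finite)
  ultimately show ?thesis by (rule finite_subset)
qed

lemma mem_comp [simp]: "w \<in> comp S v \<longleftrightarrow> conn S v w"
  by (simp add: comp_def)

lemma comp_eq_iff: "comp S u = comp S v \<longleftrightarrow> conn S u v"
proof
  assume "comp S u = comp S v"
  then have "v \<in> comp S u" by simp
  then show "conn S u v" by simp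
next
  assume "conn S u v"
  then have "conn S u w \<longleftrightarrow> conn S v w" for w by (meson conn_sym conn_trans)
  then show "comp S u = comp S v" by (simp add: set_eq_iff)
qed

lemma card_comp_pos: "forest S \<Longrightarrow> 0 < card (comp S v)"
  using finite_comp[of S v] by (metis card_gt_0_iff conn_refl empty_iff mem_comp)

text \<open>Removing a set of edges from a component separates the tails of these edges from the root.\<close>

lemma card_comp_Diff:
  assumes "forest F" "B \<subseteq> F" "\<And>e. e \<in> B \<Longrightarrow> en e \<subseteq> comp F v"
  shows "card (comp (F - B) v) + card B \<le> card (comp F v)"
proof -
  have "\<exists>x y. arc F v x e y" if e: "e \<in> B" for e
  proof -
    obtain p q where pq: "en e = {p, q}" using forest_endsE assms(1,2) e by (metis subsetD)
    then have "conn F p v" using assms(3)[OF e] conn_sym by auto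
    then show ?thesis using edge_arc[OF _ pq] assms(2) e by blast
  qed
  then obtain x y where arc: "\<And>e. e \<in> B \<Longrightarrow> arc F v (x e) e (y e)" by metis
  have inj: "inj_on x B" using arc arc_edge_unique[OF assms(1)] by (metis inj_onI)
  have sub: "x ` B \<subseteq> comp F v - comp (F - B) v"
  proof (intro image_subsetI DiffI)
    fix e assume e: "e \<in> B"
    show "x e \<in> comp F v" using arc_conn[OF arc[OF e]] conn_sym by simp
    have "\<not> conn (F - {e}) (x e) v" using arc_tail_cut[OF assms(1) arc[OF e]] .
    then have "\<not> conn (F - B) (x e) v" using conn_mono[of "F - B" "x e" v "F - {e}"] e by blast
    then show "x e \<notin> comp (F - B) v" using conn_sym by auto
  qed
  have cs: "comp (F - B) v \<subseteq> comp F v" by (auto elim: conn_mono)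
  have "card B \<le> card (comp F v - comp (F - B) v)"
    using card_mono[OF _ sub] finite_comp[OF assms(1)] inj by (simp add: card_image)
  also have "\<dots> = card (comp F v) - card (comp (F - B) v)"
    using cs finite_comp[OF assms(1)] by (meson card_Diff_subset finite_subset)
  finally show ?thesis
    using card_mono[OF finite_comp[OF assms(1)] cs] by linarith
qed

text \<open>Every vertex of \<open>W\<close> except \<open>r\<close> has an outgoing arc; these arcs
  are distinct and stay inside \<open>W\<close>.\<close>

lemma card_edges_ge:
  assumes "forest T" "finite W" "r \<in> W"
    "\<And>x. x \<in> W \<Longrightarrow> conn T x r" "\<And>x e y. x \<in> W \<Longrightarrow> arc T r x e y \<Longrightarrow> y \<in> W"
  shows "card W \<le> card {e \<in> T. en e \<subseteq> W} + 1"
proof -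
  have "\<exists>e y. arc T r x e y" if "x \<in> W - {r}" for x
    using arc_exists[OF assms(1) assms(4)[of x]] that by blast
  then obtain e y where arc: "\<And>x. x \<in> W - {r} \<Longrightarrow> arc T r x (e x) (y x)" by metis
  have "inj_on e (W - {r})" using arc arc_orient(1)[OF assms(1)] by (metis inj_onI)
  moreover have "e ` (W - {r}) \<subseteq> {e \<in> T. en e \<subseteq> W}"
  proof (intro image_subsetI)
    fix x assume x: "x \<in> W - {r}"
    then have "y x \<in> W" using assms(5) arc by blast
    then show "e x \<in> {e \<in> T. en e \<subseteq> W}" using arc[OF x] x unfolding arc_def by simp
  qed
  moreover have "finite {e \<in> T. en e \<subseteq> W}" using assms(1) forest_finite by simp
  ultimately have "card (W - {r}) \<le> card {e \<in> T. en e \<subseteq> W}" by (rule card_inj_on_le)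
  then show ?thesis using assms(2,3) by simp
qed

lemma card_edges_comp_ge:
  assumes "forest F"
  shows "card (comp F v) \<le> card {e \<in> F. en e \<subseteq> comp F v} + 1"
proof (rule card_edges_ge[OF assms finite_comp[OF assms], where r = v])
  show "y \<in> comp F v" if "x \<in> comp F v" "arc F v x e y" for x e y
    using arc_conn[OF that(2)] conn_sym by simp
qed (auto intro: conn_sym)

lemma card_edges_comp_le:
  assumes "forest F"
  shows "card {e \<in> F. en e \<subseteq> comp F v} + 1 \<le> card (comp F v)"
proof -
  let ?B = "{e \<in> F. en e \<subseteq> comp F v}"
  have "forest (F - ?B)" using assms by (rule forest_subset) blast
  then have "0 < card (comp (F - ?B) v)" by (rule card_comp_pos)
  moreover have "card (comp (F - ?B) v) + card ?B \<le> card (comp F v)"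
    by (rule card_comp_Diff[OF assms]) blast+
  ultimately show ?thesis by linarith
qed

end

section \<open>Augmenting families of forests\<close>

context edge_ends
begin

text \<open>The equation \<open>mult T n h = of_bool (h \<in> E)\<close> for all \<open>h\<close>
  says at once that the sets \<open>T b\<close> are disjoint and cover \<open>E\<close>, and
  exchanges act on it by plain arithmetic.\<close>

definition mult :: "(nat \<Rightarrow> 'e set) \<Rightarrow> nat \<Rightarrow> 'e \<Rightarrow> nat" where
  "mult T n h = (\<Sum>b<n. of_bool (h \<in> T b))"

lemma mult_upd:
  assumes "b < n"
  shows "mult (T(b := S)) n h + of_bool (h \<in> T b) = mult T n h + of_bool (h \<in> S)"
proof -
  have *: "mult T' n h = of_bool (h \<in> T' b) + (\<Sum>c\<in>{..<n} - {b}. of_bool (h \<in> T' c))" for T'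
    unfolding mult_def using assms by (intro sum.remove) auto
  have "(\<Sum>c\<in>{..<n} - {b}. of_bool (h \<in> (T(b := S)) c))
      = (\<Sum>c\<in>{..<n} - {b}. (of_bool (h \<in> T c) :: nat))"
    by (rule sum.cong) auto
  then show ?thesis using *[of T] *[of "T(b := S)"] by (simp only: fun_upd_same)
qed

lemma mult_pos: "b < n \<Longrightarrow> h \<in> T b \<Longrightarrow> 0 < mult T n h"
  unfolding mult_def by (subst sum_pos2[where i = b]) auto

lemma sum_card_inter:
  assumes "finite H"
  shows "(\<Sum>b<n. card (T b \<inter> H)) = (\<Sum>h\<in>H. mult T n h)"
proof -
  have "card (T b \<inter> H) = (\<Sum>h\<in>H. of_bool (h \<in> T b))" for b
    using assms by (simp add: of_bool_def sum.If_cases Int_commute)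
  then show ?thesis unfolding mult_def by (simp add: sum.swap[of _ H])
qed

text \<open>States of an augmenting sequence: \<open>T'\<close> is the current family and
  \<open>x\<close> the edge without a place, at first \<open>e\<close>. A swap puts \<open>x\<close>
  into one forest and drives out an edge \<open>y\<close> of the path that \<open>x\<close>
  closes.\<close>

inductive spare :: "(nat \<Rightarrow> 'e set) \<Rightarrow> nat \<Rightarrow> 'e \<Rightarrow> (nat \<Rightarrow> 'e set) \<Rightarrow> 'e \<Rightarrow> bool"
  for T n e where
  start: "spare T n e T e"
| swap: "spare T n e T' x \<Longrightarrow> b < n \<Longrightarrow> en x = {u, v} \<Longrightarrow> conn (T' b) u v \<Longrightarrow> y \<in> T' b
    \<Longrightarrow> \<not> conn (T' b - {y}) u v \<Longrightarrow> spare T n e (T'(b := insert x (T' b - {y}))) y"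

lemma spare_forest:
  assumes "spare T n e T' x" "\<And>b. b < n \<Longrightarrow> forest (T b)" "card (en e) = 2"
  shows "b < n \<Longrightarrow> forest (T' b)" "card (en x) = 2"
  using assms(1)
proof (induction arbitrary: b)
  case (swap T' x c u v y)
  {
    case 1
    then show ?case using swap.IH(1) exchange(1)[OF _ swap.hyps(5,3,4,6)] swap.hyps(2) by simp
  next
    case 2
    then show ?case using swap.IH(1)[OF swap.hyps(2)] swap.hyps(5) forest_card_ends by blast
  }
qed (use assms in auto)

lemma spare_mult:
  assumes "spare T n e T' x"
  shows "mult T' n h + of_bool (h = x) = mult T n h + of_bool (h = e)"
  using assms
proof induction
  case (swap T' x b u v y)
  let ?S = "insert x (T' b - {y})"
  \<comment> \<open>If \<open>x\<close> is already in \<open>T' b\<close>, only the removal of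
    \<open>x\<close> itself can separate its ends, so the swap changes nothing.\<close>
  have "x = y" if "x \<in> T' b"
  proof (rule ccontr)
    assume "x \<noteq> y"
    then have "conn (T' b - {y}) u v" using that swap.hyps(3) by (intro conn_edge) auto
    with swap.hyps(6) show False ..
  qed
  then have "of_bool (h \<in> ?S) + of_bool (h = y) = of_bool (h \<in> T' b) + (of_bool (h = x) :: nat)"
    using swap.hyps(5) by auto
  with mult_upd[OF swap.hyps(2), of T' ?S h] swap.IH show ?case by linarith
qed simp

text \<open>Either some spare edge fits into a forest, or \<open>X\<close> is the set of all spare
  edges. In the second case the paths found in the exchanged families consist of spare edges; as
  swaps happen inside \<open>X\<close>, they preserve the classes of \<open>T' b \<inter> X\<close>,
  so the paths may be taken in the original forests.\<close>

lemma augment: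
  assumes T: "\<And>b. b < n \<Longrightarrow> forest (T b)" and e: "card (en e) = 2"
  obtains T' where "\<And>b. b < n \<Longrightarrow> forest (T' b)" "\<And>h. mult T' n h = mult T n h + of_bool (h = e)"
  | X where "e \<in> X" "\<And>x. x \<in> X \<Longrightarrow> x = e \<or> 0 < mult T n x"
    "\<And>x u v b. x \<in> X \<Longrightarrow> en x = {u, v} \<Longrightarrow> b < n \<Longrightarrow> conn (T b \<inter> X) u v"
proof (cases "\<exists>T' x b u v. spare T n e T' x \<and> b < n \<and> en x = {u, v} \<and> \<not> conn (T' b) u v")
  case True
  then obtain T' x b u v where sp: "spare T n e T' x" and b: "b < n"
    and x: "en x = {u, v}" "\<not> conn (T' b) u v" by blast
  have fo: "forest (T' c)" if "c < n" for c using spare_forest(1)[OF sp] T e that by blast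
  have xb: "x \<notin> T' b" using x conn_edge by blast
  show thesis
  proof (rule that(1)[of "T'(b := insert x (T' b))"])
    show "forest ((T'(b := insert x (T' b))) c)" if "c < n" for c
      using that fo forest_insert[OF fo[OF b] x] by simp
    show "mult (T'(b := insert x (T' b))) n h = mult T n h + of_bool (h = e)" for h
      using mult_upd[OF b, of T' "insert x (T' b)" h] spare_mult[OF sp, of h] xb
      by (cases "h = x"; cases "h \<in> T' b") auto
  qed
next
  case False
  define X where "X = {x. \<exists>T'. spare T n e T' x}"
  have path: "conn (T' b \<inter> X) u v" if sp: "spare T n e T' x" and b: "b < n" and x: "en x = {u, v}"
    for T' x b u v
  proof -
    have c: "conn (T' b) u v" using False that by blast
    have "{y \<in> T' b. \<not> conn (T' b - {y}) u v} \<subseteq> T' b \<inter> X"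
      unfolding X_def using spare.swap[OF sp b x c] by blast
    then show ?thesis
      using conn_bridges[OF spare_forest(1)[OF sp T e b] c] by (auto intro: conn_mono)
  qed
  have inv: "conn (T' b \<inter> X) = conn (T b \<inter> X)" if "spare T n e T' x" "b < n" for T' x b
    using that
  proof induction
    case (swap T' x c u v y)
    show ?case
    proof (cases "b = c")
      case True
      let ?S = "T' b \<inter> X"
      have xX: "x \<in> X" using swap.hyps(1) unfolding X_def by blast
      have yX: "y \<in> X" using spare.swap[OF swap.hyps(1-6)] unfolding X_def by blast
      have fS: "forest ?S"
        using spare_forest(1)[OF swap.hyps(1) T e swap.prems] forest_subset by blast
      have nc: "\<not> conn (?S - {y}) u v"
        using swap.hyps(6) True conn_mono[of "?S - {y}" u v "T' b - {y}"] by blast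
      have "(T'(c := insert x (T' c - {y}))) b \<inter> X = insert x (?S - {y})"
        using True xX by auto
      moreover have "conn (insert x (?S - {y})) = conn ?S"
        using True yX swap.hyps(5)
        by (intro exchange(2)[OF fS _ swap.hyps(3) path[OF swap.hyps(1) swap.prems swap.hyps(3)] nc])
          auto
      ultimately show ?thesis using swap.IH swap.prems by simp
    qed (use swap in simp)
  qed simp
  show thesis
  proof (rule that(2)[of X])
    show "e \<in> X" unfolding X_def using spare.start by blast
    show "x = e \<or> 0 < mult T n x" if x: "x \<in> X" for x
    proof -
      obtain T' where "spare T n e T' x" using x unfolding X_def by blast
      from spare_mult[OF this, of x] show ?thesis by (cases "x = e") auto
    qed
    show "conn (T b \<inter> X) u v" if x: "x \<in> X" "en x = {u, v}" "b < n" for x u v b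
    proof -
      obtain T' where T': "spare T n e T' x" using x(1) unfolding X_def by blast
      show ?thesis using path[OF T' x(3,2)] inv[OF T' x(3)] by simp
    qed
  qed
qed

text \<open>Edges are inserted one at a time. If \<open>X\<close> blocks \<open>e\<close>, each
  forest already has \<open>card W - 1\<close> edges in the \<open>X\<close>-component
  \<open>W\<close> of \<open>e\<close>, and \<open>e\<close> is one more than the density
  allows.\<close>

lemma nash_williams:
  assumes "finite V" "finite E" and E: "\<And>e. e \<in> E \<Longrightarrow> card (en e) = 2 \<and> en e \<subseteq> V"
    and dens: "\<And>W. W \<subseteq> V \<Longrightarrow> W \<noteq> {} \<Longrightarrow> card {e \<in> E. en e \<subseteq> W} + n \<le> n * card W"
  obtains T where "\<And>b. b < n \<Longrightarrow> forest (T b)" "\<And>h. mult T n h = of_bool (h \<in> E)"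
proof -
  have "\<exists>T. (\<forall>b<n. forest (T b)) \<and> (\<forall>h. mult T n h = of_bool (h \<in> E'))"
    if "finite E'" "E' \<subseteq> E" for E'
    using that
  proof (induction rule: finite_induct)
    case empty
    show ?case by (rule exI[of _ "\<lambda>_. {}"]) (simp add: mult_def)
  next
    case (insert e E')
    then obtain T where T: "\<And>b. b < n \<Longrightarrow> forest (T b)" "\<And>h. mult T n h = of_bool (h \<in> E')"
      by auto
    have e: "card (en e) = 2" "en e \<subseteq> V" "e \<in> E" using E insert.prems by auto
    show ?case
    proof (rule augment[OF T(1) e(1)])
      fix T' assume "\<And>b. b < n \<Longrightarrow> forest (T' b)" "\<And>h. mult T' n h = mult T n h + of_bool (h = e)"
      then show ?thesis using T(2) insert.hyps(2) by (intro exI[of _ T']) auto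
    next
      fix X assume X: "e \<in> X" "\<And>x. x \<in> X \<Longrightarrow> x = e \<or> 0 < mult T n x"
        "\<And>x u v b. x \<in> X \<Longrightarrow> en x = {u, v} \<Longrightarrow> b < n \<Longrightarrow> conn (T b \<inter> X) u v"
      have XE: "X \<subseteq> E" using X(2) T(2) insert.prems e(3) by (auto split: if_splits)
      obtain u v where uv: "en e = {u, v}" using e(1) by (meson card_2_iff)
      define W where "W = comp X u"
      have WV: "W \<subseteq> V" unfolding W_def using XE E e uv by (intro comp_subset) auto
      then have fW: "finite W" using assms(1) finite_subset by blast
      have uW: "u \<in> W" by (simp add: W_def)
      have eW: "en e \<subseteq> W" using X(1) uv conn_edge[OF X(1) uv] unfolding W_def by simp
      define H where "H = {h \<in> E'. en h \<subseteq> W}"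
      have fH: "finite H" using insert.hyps(1) by (simp add: H_def)
      have TE: "T b \<subseteq> E'" if "b < n" for b
        using mult_pos[OF that, of _ T] T(2) by (auto split: if_splits)
      have ge: "card W \<le> card (T b \<inter> H) + 1" if b: "b < n" for b
      proof -
        have eq: "conn (T b \<inter> X) x y" if "conn X x y" for x y
          using that by (rule conn_le) (use X(3) b in blast)
        have "card W \<le> card {h \<in> T b \<inter> X. en h \<subseteq> W} + 1"
        proof (rule card_edges_ge[OF _ fW uW])
          show "forest (T b \<inter> X)" using T(1)[OF b] forest_subset by blast
          show "conn (T b \<inter> X) x u" if "x \<in> W" for x
            using that eq conn_sym unfolding W_def by simp
          show "y \<in> W" if "arc (T b \<inter> X) u x e' y" for x e' y
          proof -
            have "conn X y u" using arc_conn[OF that] conn_mono[of "T b \<inter> X" y u X] by blast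
            then show ?thesis unfolding W_def using conn_sym by simp
          qed
        qed
        also have "{h \<in> T b \<inter> X. en h \<subseteq> W} \<subseteq> T b \<inter> H" using TE[OF b] unfolding H_def by blast
        then have "card {h \<in> T b \<inter> X. en h \<subseteq> W} \<le> card (T b \<inter> H)" using fH by (intro card_mono) auto
        finally show ?thesis by simp
      qed
      have "n * card W = (\<Sum>b<n. card W)" by simp
      also have "\<dots> \<le> (\<Sum>b<n. card (T b \<inter> H) + 1)" using ge by (intro sum_mono) simp
      also have "\<dots> = (\<Sum>h\<in>H. mult T n h) + n"
        by (simp only: sum.distrib sum_card_inter[OF fH] sum_constant card_lessThan mult_1_right of_nat_id)
      also have "(\<Sum>h\<in>H. mult T n h) = card H"
        using T(2) by (simp add: H_def)
      finally have "n * card W \<le> card H + n" .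
      moreover have "card {e \<in> E. en e \<subseteq> W} + n \<le> n * card W" using dens[OF WV] uW by blast
      moreover have "card H < card {e \<in> E. en e \<subseteq> W}"
      proof (rule psubset_card_mono)
        show "H \<subset> {e \<in> E. en e \<subseteq> W}" using insert.prems insert.hyps(2) e(3) eW
          unfolding H_def by blast
      qed (use assms(2) in simp)
      ultimately show ?thesis by linarith
    qed
  qed
  from this[OF assms(2)] show thesis using that by blast
qed

text \<open>
  If the last forest has as few edges as possible, no edge of it can be moved to the other forests,
  so these are spanning trees of every class of the relation generated by the sets \<open>X\<close>
  of \<open>augment\<close>.
\<close>

lemma tight_cover:
  assumes "finite V" "finite E" and E: "\<And>e. e \<in> E \<Longrightarrow> card (en e) = 2 \<and> en e \<subseteq> V"
    and dens: "\<And>W. W \<subseteq> V \<Longrightarrow> W \<noteq> {} \<Longrightarrow> card {e \<in> E. en e \<subseteq> W} + (k + 1) \<le> (k + 1) * card W"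
  obtains T F X where "\<And>b. b < k \<Longrightarrow> forest (T b)" "forest F"
    "\<And>h. mult T k h + of_bool (h \<in> F) = of_bool (h \<in> E)" "F \<subseteq> X"
    "\<And>b. b < k \<Longrightarrow> conn (T b \<inter> X) = conn X"
proof -
  let ?P = "\<lambda>T F. (\<forall>b<k. forest (T b)) \<and> forest F
    \<and> (\<forall>h. mult T k h + of_bool (h \<in> F) = of_bool (h \<in> E))"
  obtain T where T: "\<And>b. b < k + 1 \<Longrightarrow> forest (T b)" "\<And>h. mult T (k + 1) h = of_bool (h \<in> E)"
    using nash_williams[OF assms] by blast
  have "?P T (T k)"
    using T by (auto simp: mult_def)
  then have "\<exists>p. ?P (fst p) (snd p)" by (intro exI[of _ "(T, T k)"]) simp
  then obtain p where p: "?P (fst p) (snd p)"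
    and min: "\<And>q. ?P (fst q) (snd q) \<Longrightarrow> card (snd p) \<le> card (snd q)"
    using ex_has_least_nat[of "\<lambda>p. ?P (fst p) (snd p)" _ "\<lambda>p. card (snd p)"] by blast
  obtain T F where TF: "p = (T, F)" by (cases p)
  have T: "\<And>b. b < k \<Longrightarrow> forest (T b)" and F: "forest F"
    and m: "\<And>h. mult T k h + of_bool (h \<in> F) = of_bool (h \<in> E)"
    using p TF by auto
  have "\<exists>X. e \<in> X \<and> (\<forall>x\<in>X. \<forall>u v. en x = {u, v} \<longrightarrow> (\<forall>b<k. conn (T b \<inter> X) u v))" if e: "e \<in> F" for e
  proof (rule augment[OF T forest_card_ends[OF F e]])
    fix T' assume T': "\<And>b. b < k \<Longrightarrow> forest (T' b)" "\<And>h. mult T' k h = mult T k h + of_bool (h = e)"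
    have "mult T' k h + of_bool (h \<in> F - {e}) = of_bool (h \<in> E)" for h
      using m[of h] T'(2)[of h] e by (cases "h \<in> E"; cases "h \<in> F") auto
    then have "?P T' (F - {e})" using T' F forest_subset by blast
    then have "card F \<le> card (F - {e})" using min[of "(T', F - {e})"] TF by simp
    moreover have "card (F - {e}) < card F" using e F forest_finite by (meson card_Diff1_less)
    ultimately show ?thesis by simp
  next
    fix X assume "e \<in> X"
      "\<And>x u v b. x \<in> X \<Longrightarrow> en x = {u, v} \<Longrightarrow> b < k \<Longrightarrow> conn (T b \<inter> X) u v"
    then show ?thesis by (intro exI[of _ X]) simp
  qed
  then obtain X where X: "\<And>e. e \<in> F \<Longrightarrow> e \<in> X e"
    "\<And>e x u v b. e \<in> F \<Longrightarrow> x \<in> X e \<Longrightarrow> en x = {u, v} \<Longrightarrow> b < k \<Longrightarrow> conn (T b \<inter> X e) u v"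
    by metis
  let ?X = "\<Union>e\<in>F. X e"
  have "conn (T b \<inter> ?X) = conn ?X" if b: "b < k" for b
  proof (intro ext iffI)
    fix u v assume "conn ?X u v"
    then show "conn (T b \<inter> ?X) u v"
    proof (rule conn_le)
      fix x s t assume "x \<in> ?X" and x: "en x = {s, t}"
      then obtain e where e: "e \<in> F" "x \<in> X e" by blast
      from X(2)[OF e x b] show "conn (T b \<inter> ?X) s t" by (rule conn_mono) (use e in blast)
    qed
  next
    fix u v assume "conn (T b \<inter> ?X) u v"
    then show "conn ?X u v" by (rule conn_mono) blast
  qed
  with that[OF T F m, of ?X] X(1) show thesis by blast
qed

end

section \<open>Exchange chains\<close>

context edge_ends
begin

text \<open>A component is represented by the vertex at which an arc enters it. The predecessor is
  not part of the data: it may be any earlier component from which some tree leads there, and is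
  chosen only for the counting.\<close>

definition legal :: "(nat \<Rightarrow> 'e set) \<Rightarrow> nat \<Rightarrow> 'e set \<Rightarrow> 'v \<Rightarrow> 'v list \<Rightarrow> bool" where
  "legal T k F r ws \<longleftrightarrow> ws \<noteq> [] \<and> ws ! 0 = r \<and>
     (\<forall>j. 0 < j \<and> j < length ws \<longrightarrow>
       (\<exists>l<j. \<exists>b<k. \<exists>u e. conn F (ws ! l) u \<and> arc (T b) r u e (ws ! j))) \<and>
     (\<forall>j<length ws. \<forall>l<j. \<not> conn F (ws ! l) (ws ! j))"

lemma legalD:
  assumes "legal T k F r ws"
  shows "ws \<noteq> []" "ws ! 0 = r" "0 < length ws"
    "j < length ws \<Longrightarrow> l < j \<Longrightarrow> \<not> conn F (ws ! l) (ws ! j)"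
  using assms unfolding legal_def by auto

lemma legal_parentE:
  assumes "legal T k F r ws" "0 < j" "j < length ws"
  obtains l b u e where "l < j" "b < k" "conn F (ws ! l) u" "arc (T b) r u e (ws ! j)"
  using assms unfolding legal_def by blast

text \<open>The arcs entering the first \<open>m + 1\<close> entries have their tails in the first
  \<open>m\<close> components. These still reach the root without \<open>A\<close>, so
  \<open>arc_survives\<close> applies.\<close>

lemma legal_take_survives:
  assumes "legal T k F r ws" "m < length ws" "b < k" "forest (T b)"
    and closed: "\<And>l u. l < m \<Longrightarrow> conn F (ws ! l) u \<Longrightarrow> conn (T b - A) u r"
    and sub: "T b - A \<subseteq> S"
  shows "legal (T(b := S)) k F r (take (Suc m) ws)"
  unfolding legal_def
proof (intro conjI allI impI)
  show "take (Suc m) ws \<noteq> []" "take (Suc m) ws ! 0 = r"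
    using legalD(1,2)[OF assms(1)] by (simp_all add: nth_take)
  fix j assume j: "j < length (take (Suc m) ws)"
  then show "\<not> conn F (take (Suc m) ws ! l) (take (Suc m) ws ! j)" if "l < j" for l
    using legalD(4)[OF assms(1), of j l] that by simp
next
  fix j assume j: "0 < j \<and> j < length (take (Suc m) ws)"
  then have "0 < j" "j < length ws" by auto
  then obtain l c u e where lc: "l < j" "c < k" "conn F (ws ! l) u" "arc (T c) r u e (ws ! j)"
    using legal_parentE[OF assms(1)] by blast
  have "arc ((T(b := S)) c) r u e (ws ! j)"
  proof (cases "c = b")
    case True
    have "conn (T b - A) u r" using closed[of l u] lc(1,3) j by simp
    then show ?thesis using arc_survives(3)[OF assms(4) _ _ sub] lc(4) True by simp
  qed (use lc in simp)
  then show "\<exists>l<j. \<exists>b'<k. \<exists>u e. conn F (take (Suc m) ws ! l) u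
      \<and> arc ((T(b := S)) b') r u e (take (Suc m) ws ! j)"
    using lc j by (intro exI[of _ l] conjI exI[of _ c] exI[of _ u] exI[of _ e]) auto
qed

lemma mult_exchange:
  assumes "b < k" "A \<subseteq> T b" "g \<notin> T b - A" "g \<notin> B" "B \<inter> (T b - A) = {}"
  shows "mult (T(b := insert g (T b - A) \<union> B)) k h + of_bool (h \<in> A)
    = mult T k h + of_bool (h \<in> B) + of_bool (h = g)"
proof -
  have "of_bool (h \<in> insert g (T b - A) \<union> B) + of_bool (h \<in> A)
      = of_bool (h \<in> T b) + of_bool (h \<in> B) + (of_bool (h = g) :: nat)"
    using assms(2-5) by auto
  then show ?thesis
    using mult_upd[OF assms(1), of T "insert g (T b - A) \<union> B" h] by linarith
qed

text \<open>
  Removing \<open>A\<close> cuts \<open>T b\<close> into pieces; let \<open>P\<close> be the one containing the root. In the first listed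
  component that leaves \<open>P\<close> there either is a red edge \<open>f\<close> leaving \<open>P\<close>, which can be added to \<open>T b\<close>,
  or that component is entered from \<open>P\<close> by an arc of another forest; this arc is moved to \<open>T b\<close>,
  and the argument is repeated for the forest that lost it.
\<close>

lemma exchange_chain:
  assumes F: "forest F" and FQ: "\<And>u v. conn F u v \<Longrightarrow> Q u v"
    and T: "\<And>b. b < k \<Longrightarrow> forest (T b)" "\<And>b. b < k \<Longrightarrow> conn (T b) = Q"
    and "legal T k F r ws" "i < length ws" "b < k" "A \<subseteq> T b"
    and "a \<in> A" "arc (T b) r x a y" "conn F (ws ! i) x"
    and "\<And>g u v. en g = {u, v} \<Longrightarrow> conn (T b - A) u r \<Longrightarrow> \<not> conn (T b - A) v r \<Longrightarrow> Q u v \<Longrightarrow>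
      \<exists>B. Sep B \<and> g \<notin> B \<and> B \<inter> (T b - A) = {} \<and> forest (insert g (T b - A) \<union> B)
        \<and> conn (insert g (T b - A) \<union> B) = Q"
  shows "\<exists>T' m f B. m \<le> i \<and> f \<in> F \<and> en f \<subseteq> comp F (ws ! m) \<and> Sep B
    \<and> (\<forall>b<k. forest (T' b) \<and> conn (T' b) = Q)
    \<and> (\<forall>h. mult T' k h + of_bool (h \<in> A) = mult T k h + of_bool (h \<in> B) + of_bool (h = f))
    \<and> legal T' k F r (take (Suc m) ws)
    \<and> (m = i \<longrightarrow> f \<notin> B \<and> \<not> conn (F - {f}) (ws ! i) x)"
  using assms(3-)
proof (induction i arbitrary: T b A a x y Sep ws rule: less_induct)
  case (less i)
  note T = less.prems(1,2) and leg = less.prems(3) and i = less.prems(4) and b = less.prems(5)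
    and A = less.prems(6) and HB = less.prems(10)
  let ?out = "\<lambda>l. \<exists>v. conn F (ws ! l) v \<and> \<not> conn (T b - A) v r"
  have "\<not> conn (T b - {a}) x r" using arc_tail_cut[OF T(1)[OF b] less.prems(8)] .
  then have "\<not> conn (T b - A) x r"
    using conn_mono[of "T b - A" x r "T b - {a}"] less.prems(7) by blast
  note xout = less.prems(9) this
  define m where "m = (LEAST l. ?out l)"
  have "?out i" using xout by blast
  then have mi: "m \<le> i" and outm: "?out m" unfolding m_def by (rule Least_le, rule LeastI)
  have inP: "conn (T b - A) u r" if "l < m" "conn F (ws ! l) u" for l u
    using not_less_Least[of l ?out] that unfolding m_def by blast
  have mlen: "m < length ws" using mi i by simp
  have upd: "(\<forall>c<k. forest ((T(b := S)) c) \<and> conn ((T(b := S)) c) = Q)"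
    if "forest S" "conn S = Q" for S
    using that T by simp
  show ?case
  proof (cases "conn (T b - A) (ws ! m) r")
    case True
    \<comment> \<open>For \<open>m = i\<close> the tail \<open>x\<close> itself is taken as
      \<open>v\<close>, so that \<open>f\<close> separates it from \<open>ws ! i\<close>, as the
      last conjunct demands.\<close>
    obtain v where v: "conn F (ws ! m) v" "\<not> conn (T b - A) v r" "m = i \<Longrightarrow> v = x"
      using outm xout by (cases "m = i") auto
    obtain f p q where f: "f \<in> {y \<in> F. \<not> conn (F - {y}) (ws ! m) v}" "en f = {p, q}"
      "p \<in> {w. conn (T b - A) w r}" "q \<notin> {w. conn (T b - A) w r}"
      using conn_cross[OF conn_bridges[OF F v(1)], of "{w. conn (T b - A) w r}"] True v(2) by blast
    have fF: "f \<in> F" and sep: "\<not> conn (F - {f}) (ws ! m) v" using f(1) by auto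
    have Qpq: "Q p q" using FQ conn_edge[OF fF f(2)] .
    obtain B where B: "Sep B" "f \<notin> B" "B \<inter> (T b - A) = {}" "forest (insert f (T b - A) \<union> B)"
      "conn (insert f (T b - A) \<union> B) = Q"
      using HB[OF f(2) _ _ Qpq] f(3,4) by blast
    have fT: "f \<notin> T b - A"
    proof
      assume "f \<in> T b - A"
      then have "conn (T b - A) q p" using f(2) conn_edge conn_sym by blast
      with f(3,4) show False using conn_trans by blast
    qed
    obtain p' q' where pq': "en f = {p', q'}" "conn (F - {f}) (ws ! m) p'"
      using conn_edge_removeE[OF v(1) sep fF forest_card_ends[OF F fF]] by blast
    have "F - {f} \<subseteq> F" by blast
    with pq'(2) have "conn F (ws ! m) p'" by (rule conn_mono)
    moreover from this have "conn F (ws ! m) q'" using conn_edge[OF fF pq'(1)] conn_trans by blast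
    ultimately have enf: "en f \<subseteq> comp F (ws ! m)" using pq'(1) by simp
    show ?thesis
    proof (rule exI[of _ "T(b := insert f (T b - A) \<union> B)"], rule exI[of _ m], rule exI[of _ f],
        rule exI[of _ B], intro conjI)
      show "legal (T(b := insert f (T b - A) \<union> B)) k F r (take (Suc m) ws)"
        by (rule legal_take_survives[OF leg mlen b T(1)[OF b], where A = A]) (use inP in blast)+
      show "m = i \<longrightarrow> f \<notin> B \<and> \<not> conn (F - {f}) (ws ! i) x"
        using B(2) sep v(3) by auto
      show "\<forall>h. mult (T(b := insert f (T b - A) \<union> B)) k h + of_bool (h \<in> A)
          = mult T k h + of_bool (h \<in> B) + of_bool (h = f)"
        by (intro allI mult_exchange b A fT B(2,3))
    qed (use mi fF enf B(1) upd[OF B(4,5)] in auto)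
  next
    case False
    have m0: "0 < m" using False legalD(2)[OF leg] by (cases m) auto
    obtain l c u e where e: "l < m" "c < k" "conn F (ws ! l) u" "arc (T c) r u e (ws ! m)"
      using legal_parentE[OF leg m0 mlen] by blast
    have u: "conn (T b - A) u r" using inP e(1,3) by blast
    \<comment> \<open>Were \<open>e\<close> an arc of \<open>T b\<close>, its head
      \<open>ws ! m\<close> would reach the root without \<open>A\<close> because its tail
      does.\<close>
    have cb: "c \<noteq> b"
      using arc_survives(2)[OF T(1)[OF b] _ u, of e "ws ! m"] e(4) False by blast
    have ee: "e \<in> T c" "en e = {u, ws ! m}" using e(4) unfolding arc_def by auto
    have Qe: "Q u (ws ! m)" using conn_edge[OF ee] T(2)[OF e(2)] by simp
    obtain B where B: "Sep B" "e \<notin> B" "B \<inter> (T b - A) = {}" "forest (insert e (T b - A) \<union> B)"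
      "conn (insert e (T b - A) \<union> B) = Q"
      using HB[OF ee(2) u False Qe] by blast
    have eT: "e \<notin> T b - A"
    proof
      assume "e \<in> T b - A"
      then have "conn (T b - A) (ws ! m) u" using ee(2) conn_edge conn_sym by blast
      then show False using u False conn_trans by blast
    qed
    define T1 where "T1 = T(b := insert e (T b - A) \<union> B)"
    have T1c: "T1 c = T c" unfolding T1_def using cb by simp
    have li: "l < i" using e(1) mi by simp
    let ?ws = "take (Suc m) ws"
    \<comment> \<open>The tree that lost \<open>e\<close> is repaired at an earlier entry, so the
      chain ends. A single lost arc needs a single new edge, hence \<open>Sep\<close> is now
      instantiated by emptiness.\<close>
    have "\<exists>T' m' f B'. m' \<le> l \<and> f \<in> F \<and> en f \<subseteq> comp F (?ws ! m') \<and> B' = {}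
      \<and> (\<forall>b<k. forest (T' b) \<and> conn (T' b) = Q)
      \<and> (\<forall>h. mult T' k h + of_bool (h \<in> {e}) = mult T1 k h + of_bool (h \<in> B') + of_bool (h = f))
      \<and> legal T' k F r (take (Suc m') ?ws)
      \<and> (m' = l \<longrightarrow> f \<notin> B' \<and> \<not> conn (F - {f}) (?ws ! l) u)"
    proof (rule less.IH[OF li])
      show "forest (T1 b')" "conn (T1 b') = Q" if "b' < k" for b'
        using upd[OF B(4,5)] that unfolding T1_def by blast+
      show "legal T1 k F r ?ws" unfolding T1_def
        by (rule legal_take_survives[OF leg mlen b T(1)[OF b], where A = A]) (use inP in blast)+
      show "l < length ?ws" using e(1) mlen by simp
      show "c < k" by fact
      show "{e} \<subseteq> T1 c" "e \<in> {e}" "arc (T1 c) r u e (ws ! m)" using T1c ee e(4) by auto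
      show "conn F (?ws ! l) u" using e(1,3) by simp
      show "\<exists>B'. B' = {} \<and> g \<notin> B' \<and> B' \<inter> (T1 c - {e}) = {} \<and> forest (insert g (T1 c - {e}) \<union> B')
          \<and> conn (insert g (T1 c - {e}) \<union> B') = Q"
        if g: "en g = {s, t}" "conn (T1 c - {e}) s r" "\<not> conn (T1 c - {e}) t r" "Q s t" for g s t
      proof -
        have "\<not> conn (T c - {e}) s t" using g(2,3) T1c by (metis conn_sym conn_trans)
        moreover have "conn (T c) s t" using g(4) T(2)[OF e(2)] by simp
        ultimately show ?thesis
          using exchange[OF T(1)[OF e(2)] ee(1) g(1)] T1c T(2)[OF e(2)] by simp
      qed
    qed
    then obtain T' m' f where T': "m' \<le> l" "f \<in> F" "en f \<subseteq> comp F (?ws ! m')"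
      "\<forall>b<k. forest (T' b) \<and> conn (T' b) = Q"
      "\<And>h. mult T' k h + of_bool (h \<in> {e}) = mult T1 k h + of_bool (h = f)"
      "legal T' k F r (take (Suc m') ?ws)"
      by auto
    show ?thesis
    proof (rule exI[of _ T'], rule exI[of _ m'], rule exI[of _ f], rule exI[of _ B], intro conjI)
      show "m' \<le> i" "m' = i \<longrightarrow> f \<notin> B \<and> \<not> conn (F - {f}) (ws ! i) x" using T'(1) li by auto
      show "en f \<subseteq> comp F (ws ! m')" using T'(1,3) e(1) by simp
      show "legal T' k F r (take (Suc m') ws)" using T'(1,6) e(1) by (simp add: min_def)
      show "\<forall>h. mult T' k h + of_bool (h \<in> A) = mult T k h + of_bool (h \<in> B) + of_bool (h = f)"
      proof
        fix h
        have "mult T1 k h + of_bool (h \<in> A) = mult T k h + of_bool (h \<in> B) + of_bool (h = e)"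
          unfolding T1_def by (intro mult_exchange b A eT B(2,3))
        with T'(5)[of h]
        show "mult T' k h + of_bool (h \<in> A) = mult T k h + of_bool (h \<in> B) + of_bool (h = f)"
          by simp
      qed
    qed (use T' B(1) in auto)
  qed
qed

subsection \<open>Separating up to three vertices of a red component\<close>

text \<open>Follow the path from \<open>x\<close> to \<open>y\<close> until it first leaves
  \<open>P\<close>. The last conclusion records that the part before stays inside \<open>P\<close>,
  which \<open>separate_three\<close> needs.\<close>

lemma exit_edge:
  assumes F: "forest F" and "conn F x y" "x \<in> P" "y \<notin> P"
  obtains e p q where "e \<in> F" "en e = {p, q}" "p \<in> P" "q \<notin> P"
    "\<not> conn (F - {e}) x y" "conn (F - {e}) x p" "conn (F - {e}) q y"
    "conn {f \<in> F. en f \<subseteq> P} x p"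
proof -
  let ?S = "{y' \<in> F. \<not> conn (F - {y'}) x y}"
  have "z \<in> P \<and> conn {f \<in> ?S. en f \<subseteq> P} x z
      \<or> (\<exists>e\<in>?S. \<exists>p q. en e = {p, q} \<and> p \<in> P \<and> q \<notin> P \<and> conn {f \<in> ?S. en f \<subseteq> P} x p)"
    if "conn ?S x z" for z
    using that unfolding conn_def[of ?S]
  proof (induction rule: rtranclp_induct)
    case base
    then show ?case using assms(3) by simp
  next
    case (step z z')
    then obtain e where e: "e \<in> ?S" "en e = {z, z'}" by blast
    show ?case
    proof (cases "z \<in> P \<and> conn {f \<in> ?S. en f \<subseteq> P} x z")
      case zP: True
      show ?thesis
      proof (cases "z' \<in> P")
        case True
        then have "conn {f \<in> ?S. en f \<subseteq> P} z z'" using e zP by (intro conn_edge[of e]) auto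
        with zP True show ?thesis using conn_trans by blast
      qed (use zP e in blast)
    qed (use step.IH in blast)
  qed
  from this[OF conn_bridges[OF F assms(2)]] assms(4)
  obtain e p q where e: "e \<in> ?S" "en e = {p, q}" "p \<in> P" "q \<notin> P"
    and xp: "conn {f \<in> ?S. en f \<subseteq> P} x p" by blast
  have "{f \<in> ?S. en f \<subseteq> P} \<subseteq> {f \<in> F. en f \<subseteq> P}" "{f \<in> ?S. en f \<subseteq> P} \<subseteq> F - {e}" using e by auto
  then have c: "conn {f \<in> F. en f \<subseteq> P} x p" "conn (F - {e}) x p" using xp conn_mono by blast+
  have "e \<in> F" and s: "\<not> conn (F - {e}) x y" using e(1) by auto
  moreover have "conn (F - {e}) q y"
    using conn_remove_split[OF assms(2) e(2)] s c(2) by (meson conn_sym conn_trans)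
  ultimately show thesis using that e(2-4) c by blast
qed

lemma crossing_edge:
  assumes "forest F" "conn F x y" "\<not> conn S x y"
  obtains e where "e \<in> F" "e \<notin> S" "en e \<subseteq> comp F x" "\<And>p q. en e = {p, q} \<Longrightarrow> \<not> conn S p q"
    "\<not> conn (F - {e}) x y"
proof -
  have "x \<in> comp S x" "y \<notin> comp S x" using assms(3) by auto
  from exit_edge[OF assms(1,2) this]
  obtain e p q where e: "e \<in> F" "en e = {p, q}" "p \<in> comp S x" "q \<notin> comp S x"
    "\<not> conn (F - {e}) x y" "conn (F - {e}) x p" "conn (F - {e}) q y"
    "conn {f \<in> F. en f \<subseteq> comp S x} x p" .
  have "\<not> conn S p q" using e(3,4) conn_trans[of S x p q] by auto
  moreover from this have "e \<notin> S" using e(2) conn_edge by blast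
  moreover have "conn F x p" using e(6) by (rule conn_mono) blast
  moreover from this have "conn F x q" using conn_edge[OF e(1,2)] by (rule conn_trans)
  moreover have "\<not> conn S p' q'" if "en e = {p', q'}" for p' q'
    using that e(2) \<open>\<not> conn S p q\<close> conn_sym[of S p' q'] by (auto simp: doubleton_eq_iff)
  ultimately show thesis using that e(1,2,5) by simp
qed

text \<open>The edge \<open>e\<close> cuts \<open>c\<close> off from \<open>a\<close> and
  \<open>b\<close>. On the remaining path from \<open>a\<close> to \<open>b\<close> some edge joins
  two classes of \<open>insert e S\<close>; it separates \<open>a\<close> from \<open>b\<close> and
  closes no cycle.\<close>

lemma separate_third:
  assumes F: "forest F" and S: "forest S" and e: "e \<in> F" "en e = {p, q}" "\<not> conn S p q" "conn F a p"
    and ab: "conn (F - {e}) a b" "\<not> conn (insert e S) a b" and ac: "\<not> conn (F - {e}) a c"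
  shows "\<exists>B\<subseteq>F. card B = 2 \<and> B \<inter> S = {} \<and> forest (S \<union> B) \<and> (\<forall>f\<in>B. en f \<subseteq> comp F a)
    \<and> \<not> conn (F - B) a b \<and> \<not> conn (F - B) a c \<and> \<not> conn (F - B) b c"
proof -
  have eS: "e \<notin> S" using e conn_edge by blast
  have fe: "forest (insert e S)" using forest_insert[OF S e(2,3)] .
  have "forest (F - {e})" using F forest_subset by blast
  then obtain f where f: "f \<in> F - {e}" "f \<notin> insert e S" "en f \<subseteq> comp (F - {e}) a"
    "\<And>p q. en f = {p, q} \<Longrightarrow> \<not> conn (insert e S) p q" "\<not> conn (F - {e} - {f}) a b"
    using crossing_edge[OF _ ab] by blast
  obtain s t where st: "en f = {s, t}" using forest_endsE[OF F] f(1) by blast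
  have "forest (insert f (insert e S))" using forest_insert[OF fe st f(4)[OF st]] .
  then have fo: "forest (S \<union> {e, f})" by (simp add: insert_commute)
  have eq: "F - {e, f} = F - {e} - {f}" by blast
  have nbc: "\<not> conn (F - {e}) b c" using ab(1) ac conn_trans by blast
  have "\<not> conn (F - {e, f}) u v" if "\<not> conn (F - {e}) u v" for u v
    using that conn_mono[of "F - {e, f}" u v "F - {e}"] by blast
  then have sep: "\<not> conn (F - {e, f}) a c" "\<not> conn (F - {e, f}) b c" using ac nbc by blast+
  have "conn F a q" using e(4) conn_edge[OF e(1,2)] by (rule conn_trans)
  then have ene: "en e \<subseteq> comp F a" using e(2,4) by simp
  have "comp (F - {e}) a \<subseteq> comp F a" by (auto elim!: conn_mono)
  then have enf: "en f \<subseteq> comp F a" using f(3) by blast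
  have "card {e, f} = 2" using f(1) by auto
  then show ?thesis
    using e(1) f(1,2,5) eS fo sep ene enf eq by (intro exI[of _ "{e, f}"]) auto
qed

text \<open>The obstacle is not the separation but that both edges must fit into \<open>S\<close>
  without a cycle. \<open>separate_third\<close> applies unless the first edge joins the classes of
  the two vertices that it leaves together; then the start is moved to the vertex cut off.\<close>

lemma separate_three:
  assumes F: "forest F" and S: "forest S" and F12: "conn F x1 x2" and F13: "conn F x1 x3"
    and n12: "\<not> conn S x1 x2" and n13: "\<not> conn S x1 x3" and n23: "\<not> conn S x2 x3"
  shows "\<exists>B\<subseteq>F. card B = 2 \<and> B \<inter> S = {} \<and> forest (S \<union> B) \<and> (\<forall>f\<in>B. en f \<subseteq> comp F x1)
    \<and> \<not> conn (F - B) x1 x2 \<and> \<not> conn (F - B) x1 x3 \<and> \<not> conn (F - B) x2 x3"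
proof -
  \<comment> \<open>The easy case: the first exit from the class of \<open>a\<close> towards \<open>b\<close> does not separate \<open>b\<close> from \<open>c\<close>.\<close>
  have easy: "\<exists>B\<subseteq>F. card B = 2 \<and> B \<inter> S = {} \<and> forest (S \<union> B) \<and> (\<forall>f\<in>B. en f \<subseteq> comp F b)
    \<and> \<not> conn (F - B) b c \<and> \<not> conn (F - B) b a \<and> \<not> conn (F - B) c a"
    if e: "e \<in> F" "en e = {p, q}" "conn S a p" "\<not> conn S a q"
      and Fa: "conn (F - {e}) a p" "conn F a b" "\<not> conn (F - {e}) a b" "conn (F - {e}) b c"
      and n: "\<not> conn S a b" "\<not> conn S a c" "\<not> conn S b c" for a b c e p q
  proof (rule separate_third[OF F S e(1,2)])
    show "\<not> conn S p q" using e(3,4) conn_trans by blast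
    have "conn F a p" using Fa(1) by (rule conn_mono) blast
    with Fa(2) show "conn F b p" by (meson conn_sym conn_trans)
    show "\<not> conn (insert e S) b c"
      using conn_insert_split[OF _ e(2), of S b c] n e(3) by (meson conn_sym conn_trans)
    show "\<not> conn (F - {e}) b a" using Fa(3) conn_sym by blast
  qed fact
  let ?P1 = "comp S x1" and ?P2 = "comp S x2"
  have "x1 \<in> ?P1" "x2 \<notin> ?P1" using n12 by auto
  from exit_edge[OF F F12 this]
  obtain e p q where e: "e \<in> F" "en e = {p, q}" "p \<in> ?P1" "q \<notin> ?P1"
    "\<not> conn (F - {e}) x1 x2" "conn (F - {e}) x1 p" "conn (F - {e}) q x2"
    "conn {f \<in> F. en f \<subseteq> ?P1} x1 p" .
  have Sp: "conn S x1 p" "\<not> conn S x1 q" using e(3,4) by auto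
  have comps: "comp F x2 = comp F x1" using F12 conn_sym comp_eq_iff by blast
  show ?thesis
  proof (cases "conn (F - {e}) x2 x3")
    case True
    show ?thesis
      using easy[OF e(1,2) Sp e(6) F12 e(5) True n12 n13 n23] comps by (simp add: conn_commute) metis
  next
    case False
    have x13: "conn (F - {e}) x1 x3"
      using conn_remove_split[OF F13 e(2)] e(6,7) False by (meson conn_sym conn_trans)
    show ?thesis
    proof (cases "conn S q x3")
      case q3: False
      have "\<exists>B\<subseteq>F. card B = 2 \<and> B \<inter> S = {} \<and> forest (S \<union> B) \<and> (\<forall>f\<in>B. en f \<subseteq> comp F x1)
        \<and> \<not> conn (F - B) x1 x3 \<and> \<not> conn (F - B) x1 x2 \<and> \<not> conn (F - B) x3 x2"
      proof (rule separate_third[OF F S e(1,2) _ _ x13 _ e(5)])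
        show "\<not> conn S p q" using Sp conn_trans by blast
        show "conn F x1 p" using e(6) by (rule conn_mono) blast
        show "\<not> conn (insert e S) x1 x3"
          using conn_insert_split[OF _ e(2), of S x1 x3] n13 Sp(2) q3 by blast
      qed
      then show ?thesis by (simp add: conn_commute) metis
    next
      case q3: True
      have F21: "conn F x2 x1" using F12 conn_sym by blast
      have "x2 \<in> ?P2" "x1 \<notin> ?P2" using n12 conn_sym by auto
      from exit_edge[OF F F21 this]
      obtain e' p' q' where e': "e' \<in> F" "en e' = {p', q'}" "p' \<in> ?P2" "q' \<notin> ?P2"
        "\<not> conn (F - {e'}) x2 x1" "conn (F - {e'}) x2 p'" "conn (F - {e'}) q' x1"
        "conn {f \<in> F. en f \<subseteq> ?P2} x2 p'" .
      have Sp': "conn S x2 p'" "\<not> conn S x2 q'" using e'(3,4) by auto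
      have pP2: "p \<notin> ?P2" using Sp(1) n12 by (simp, meson conn_sym conn_trans)
      \<comment> \<open>The path from \<open>x2\<close> to \<open>p'\<close> stays in the class of
        \<open>x2\<close> and so misses \<open>e\<close>, whose end \<open>p\<close> lies outside.
        Hence \<open>e\<close> has \<open>p'\<close> on the side of \<open>x2\<close>, away from
        \<open>x1\<close> and \<open>x3\<close>, and \<open>e'\<close> cannot lie on the path
        between those two.\<close>
      have "conn (F - {e'}) x1 x3"
      proof -
        have "{f \<in> F. en f \<subseteq> ?P2} \<subseteq> F - {e}" using e(2) pP2 by auto
        then have x2p': "conn (F - {e}) x2 p'" using e'(8) conn_mono by blast
        have m: "conn (F - {e}) s t" "conn (F - {e'}) s t" if "conn (F - {e} - {e'}) s t" for s t
          using that by (auto elim!: conn_mono)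
        show ?thesis
          using conn_remove_split[OF x13 e'(2)] m x2p' e(5) False by (meson conn_sym conn_trans)
      qed
      note x13' = this
      have n21: "\<not> conn S x2 x1" using n12 conn_sym by blast
      show ?thesis
        using easy[OF e'(1,2) Sp' e'(6) F21 e'(5) x13' n21 n23 n13] by (simp add: conn_commute) metis
    qed
  qed
qed

text \<open>With \<open>card B + 1 = card X\<close>, a tree that loses \<open>card X\<close> arcs
  and gains \<open>B\<close> and one more edge keeps its size.\<close>

lemma separator:
  assumes F: "forest F" and S: "forest S" and X: "X \<subseteq> comp F w"
    and n: "\<And>u v. u \<in> X \<Longrightarrow> v \<in> X \<Longrightarrow> u \<noteq> v \<Longrightarrow> \<not> conn S u v"
    and card: "1 \<le> card X" "card X \<le> 3"
  shows "\<exists>B\<subseteq>F. card B + 1 = card X \<and> B \<inter> S = {} \<and> forest (S \<union> B) \<and> (\<forall>f\<in>B. en f \<subseteq> comp F w)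
    \<and> (\<forall>u\<in>X. \<forall>v\<in>X. u \<noteq> v \<longrightarrow> \<not> conn (F - B) u v)"
proof -
  have cw: "comp F u = comp F w" if "u \<in> X" for u using X that by (metis comp_eq_iff mem_comp subsetD)
  have cF: "conn F u v" if "u \<in> X" "v \<in> X" for u v using cw that comp_eq_iff by metis
  from card consider "card X = 1" | "card X = 2" | "card X = 3" by linarith
  then show ?thesis
  proof cases
    case 1
    then obtain x where "X = {x}" by (metis card_1_singletonE)
    then show ?thesis using S by (intro exI[of _ "{}"]) auto
  next
    case 2
    then obtain x y where xy: "X = {x, y}" "x \<noteq> y" by (meson card_2_iff)
    then have xyX: "x \<in> X" "y \<in> X" by auto
    obtain f where f: "f \<in> F" "f \<notin> S" "en f \<subseteq> comp F x"
      "\<And>p q. en f = {p, q} \<Longrightarrow> \<not> conn S p q" "\<not> conn (F - {f}) x y"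
      using crossing_edge[OF F cF[OF xyX] n[OF xyX xy(2)]] by blast
    obtain s t where st: "en f = {s, t}" using forest_endsE[OF F f(1)] by blast
    have "forest (insert f S)" using forest_insert[OF S st f(4)[OF st]] .
    then show ?thesis
      using f xy cw 2 by (intro exI[of _ "{f}"]) (auto dest: conn_sym)
  next
    case 3
    then obtain x y z where xyz: "X = {x, y, z}" "x \<noteq> y" "x \<noteq> z" "y \<noteq> z" by (metis card_3_iff)
    then have "x \<in> X" "y \<in> X" "z \<in> X" by auto
    from separate_three[OF F S cF[OF this(1,2)] cF[OF this(1,3)] n[OF this(1,2) xyz(2)]
        n[OF this(1,3) xyz(3)] n[OF this(2,3) xyz(4)]]
    obtain B where "B \<subseteq> F" "card B = 2" "B \<inter> S = {}" "forest (S \<union> B)" "\<forall>f\<in>B. en f \<subseteq> comp F x"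
      "\<not> conn (F - B) x y" "\<not> conn (F - B) x z" "\<not> conn (F - B) y z" by blast
    then show ?thesis
      using xyz(1) cw[OF \<open>x \<in> X\<close>] 3 by (intro exI[of _ B]) (auto dest: conn_sym)
  qed
qed


text \<open>If the tails stayed joined, \<open>y'\<close> would lie behind \<open>a\<close> as well,
  so its path to \<open>r\<close>, which avoids \<open>a'\<close>, would run through
  \<open>x\<close>. Together with the connection of the tails this bypasses the bridge
  \<open>a'\<close>.\<close>

lemma arcs_cut:
  assumes T: "forest T" and a: "arc T r x a y" "arc T r x' a' y'" and "a \<noteq> a'"
    and A: "a \<in> A" "a' \<in> A"
  shows "\<not> conn (T - A) x x'"
proof
  assume "conn (T - A) x x'"
  then have c: "conn (T - {a, a'}) x x'" by (rule conn_mono) (use A in blast)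
  have m: "conn (T - {a}) u v" "conn (T - {a'}) u v" if "conn (T - {a, a'}) u v" for u v
    using that by (auto elim!: conn_mono)
  have ea: "a \<in> T" "en a = {x, y}" "a' \<in> T" "en a' = {x', y'}" "conn (T - {a'}) y' r"
    using a unfolding arc_def by auto
  have eq: "T - {a'} - {a} = T - {a, a'}" by blast
  have cut: "\<not> conn (T - {a}) x r" "\<not> conn (T - {a'}) x' r" using arc_tail_cut T a by blast+
  have br: "\<not> conn (T - {a'}) x' y'" using forest_bridge[OF T ea(3,4)] .
  have "conn (T - {a}) x' y'" using ea(3,4) \<open>a \<noteq> a'\<close> by (intro conn_edge[of a']) auto
  then have "\<not> conn (T - {a}) y' r" using m(1)[OF c] cut(1) conn_trans by blast
  then have "conn (T - {a, a'}) y' x"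
    using conn_remove_split[OF ea(5,2)] cut m unfolding eq by (meson c conn_sym conn_trans)
  then have "conn (T - {a'}) x' y'" using m(2)[OF c] m(2) by (meson conn_sym conn_trans)
  with br show False ..
qed

lemma comp_Diff_eq:
  assumes "\<And>e. e \<in> R \<Longrightarrow> en e \<inter> comp F v = {}"
  shows "comp (F - R) v = comp F v"
proof
  show "comp (F - R) v \<subseteq> comp F v" by (auto elim: conn_mono)
  show "comp F v \<subseteq> comp (F - R) v"
  proof
    fix z assume "z \<in> comp F v"
    then have "conn F v z" by simp
    then show "z \<in> comp (F - R) v"
    proof (rule conn_invariant)
      fix e s t assume e: "e \<in> F" "en e = {s, t}" and s: "s \<in> comp (F - R) v"
      then have "conn F v s" using conn_mono[of "F - R" v s F] by auto
      then have "e \<notin> R" using assms e(2) by fastforce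
      then have "conn (F - R) s t" using e by (intro conn_edge[of e]) auto
      with s show "t \<in> comp (F - R) v" using conn_trans by simp
    qed simp
  qed
qed

end

text \<open>Adding \<open>A\<close> to the red forest hangs the components at the heads as leaves
  onto the component of \<open>w\<close>, the centre. In the lemmas \<open>S\<close> is what is left
  of \<open>F\<close> after some edges were removed.\<close>

locale star = edge_ends en for en :: "'e \<Rightarrow> 'v set" +
  fixes F A :: "'e set" and w :: 'v and x y :: "'e \<Rightarrow> 'v"
  assumes F: "forest F" and finite_A: "finite A"
    and ends_A: "a \<in> A \<Longrightarrow> en a = {x a, y a}"
    and tail_A: "a \<in> A \<Longrightarrow> conn F w (x a)"
    and head_A: "a \<in> A \<Longrightarrow> \<not> conn F w (y a)"
    and distinct_A: "a \<in> A \<Longrightarrow> a' \<in> A \<Longrightarrow> conn F (y a) (y a') \<Longrightarrow> a = a'"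
begin

text \<open>Only the splitting of the centre is tracked; a leaf is counted with its whole old
  component, which suffices for upper bounds.\<close>

lemma comp_star:
  assumes "S \<subseteq> F" "A' \<subseteq> A" "conn F w p"
  shows "comp (S \<union> A') p \<subseteq> comp S p \<union> (\<Union>a\<in>{a \<in> A'. conn S p (x a)}. comp F (y a))"
    (is "_ \<subseteq> ?W")
proof
  have SF: "conn F u v" if "conn S u v" for u v using that assms(1) by (rule conn_mono)
  fix z assume "z \<in> comp (S \<union> A') p"
  then have "conn (S \<union> A') p z" by simp
  then show "z \<in> ?W"
  proof (rule conn_invariant)
    fix e s t assume e: "e \<in> S \<union> A'" "en e = {s, t}" and s: "s \<in> ?W"
    show "t \<in> ?W"
    proof (cases "e \<in> S")
      case True
      then have st: "conn S s t" "conn F s t" using e(2) assms(1) conn_edge by blast+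
      from s consider "conn S p s" | a where "a \<in> A'" "conn S p (x a)" "conn F (y a) s" by auto
      then show ?thesis
      proof cases
        case 1
        then have "conn S p t" using st(1) by (rule conn_trans)
        then show ?thesis by simp
      next
        case 2
        then have "conn F (y a) t" using st(2) conn_trans by blast
        with 2 show ?thesis by auto
      qed
    next
      case False
      then have eA: "e \<in> A'" "e \<in> A" using e(1) assms(2) by auto
      then have xy: "{s, t} = {x e, y e}" using ends_A e(2) by simp
      have wx: "conn F w (x e)" and wy: "\<not> conn F w (y e)" using tail_A head_A eA(2) by auto
      have nx: "\<not> conn F (y a) (x e)" if "a \<in> A" for a
        using head_A[OF that] wx by (meson conn_sym conn_trans)
      have ny: "\<not> conn S p (y e)" using SF[of p "y e"] assms(3) wy conn_trans by blast
      have "conn S p (x e)"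
      proof (cases "s = x e")
        case True
        then show ?thesis using s nx assms(2) by auto
      next
        case False
        then have "s = y e" using xy by (auto simp: doubleton_eq_iff)
        then obtain a where a: "a \<in> A'" "conn S p (x a)" "conn F (y a) (y e)"
          using s ny by auto
        then have "a = e" using distinct_A eA(2) assms(2) by blast
        with a show ?thesis by simp
      qed
      then have "x e \<in> ?W" "y e \<in> ?W" using eA(1) by auto
      then show ?thesis using xy by (auto simp: doubleton_eq_iff)
    qed
  qed simp
qed

lemma forest_star: "forest (F \<union> A)"
proof -
  have "forest (F \<union> A')" if "finite A'" "A' \<subseteq> A" for A'
    using that
  proof (induction rule: finite_induct)
    case (insert a A')
    have a: "a \<in> A" "A' \<subseteq> A" using insert.prems by auto
    have "y a \<notin> comp (F \<union> A') (x a)"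
    proof
      assume "y a \<in> comp (F \<union> A') (x a)"
      then consider "conn F (x a) (y a)" | a' where "a' \<in> A'" "conn F (y a') (y a)"
        using comp_star[OF order_refl a(2) tail_A[OF a(1)]] by auto
      then show False
      proof cases
        case 1
        then show ?thesis using tail_A[OF a(1)] head_A[OF a(1)] conn_trans by blast
      next
        case 2
        then show ?thesis using distinct_A[of a' a] a insert.hyps(2) by blast
      qed
    qed
    then show ?case using forest_insert[OF insert.IH[OF a(2)] ends_A[OF a(1)]] by simp
  qed (use F in simp)
  then show ?thesis using finite_A by blast
qed

lemma comp_star_outside:
  assumes "comp (S \<union> A) v \<inter> comp F w = {}"
  shows "comp (S \<union> A) v \<subseteq> comp S v"
proof
  fix z assume "z \<in> comp (S \<union> A) v"
  then have "conn (S \<union> A) v z" by simp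
  then show "z \<in> comp S v"
  proof (rule conn_invariant)
    fix e s t assume e: "e \<in> S \<union> A" "en e = {s, t}" and s: "s \<in> comp S v"
    then have vs: "conn (S \<union> A) v s" using conn_mono[of S v s "S \<union> A"] by auto
    have "e \<in> S"
    proof (rule ccontr)
      assume "e \<notin> S"
      then have eA: "e \<in> A" using e(1) by blast
      have "conn (S \<union> A) s t" using conn_edge[OF e] .
      with vs have "conn (S \<union> A) v t" by (rule conn_trans)
      with vs have "conn (S \<union> A) v (x e)"
        using ends_A[OF eA] e(2) by (auto simp: doubleton_eq_iff)
      with assms tail_A[OF eA] show False by auto
    qed
    then have "conn S s t" using e(2) conn_edge by blast
    with s show "t \<in> comp S v" using conn_trans by simp
  qed simp
qed

text \<open>The vertices whose component may grow when \<open>A\<close> is added; elsewhere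
  components can only shrink, by \<open>comp_outside_zone\<close>.\<close>

definition zone :: "'v set" where
  "zone = comp F w \<union> (\<Union>a\<in>A. comp F (y a))"

lemma comp_star_zone:
  assumes "S \<subseteq> F" "p \<in> comp F w"
  shows "comp (S \<union> A) p \<subseteq> zone"
proof -
  have "comp S p \<subseteq> comp F p" using assms(1) by (auto elim: conn_mono)
  also have "comp F p = comp F w" using assms(2) comp_eq_iff[of F w p] by simp
  finally show ?thesis
    using comp_star[OF assms(1) order_refl, of p] assms(2) unfolding zone_def by auto
qed

lemma comp_outside_zone:
  assumes "S \<subseteq> F" "v \<notin> zone"
  shows "comp (S \<union> A) v \<subseteq> comp S v"
proof (rule comp_star_outside, rule ccontr)
  assume "comp (S \<union> A) v \<inter> comp F w \<noteq> {}"
  then obtain p where p: "conn (S \<union> A) v p" "p \<in> comp F w" by auto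
  then have "v \<in> comp (S \<union> A) p" using conn_sym by simp
  then show False using comp_star_zone[OF assms(1) p(2)] assms(2) by blast
qed

lemma comp_in_zone:
  assumes "S \<subseteq> F" "v \<in> zone"
  obtains p where "p \<in> comp F w" "comp (S \<union> A) v = comp (S \<union> A) p"
  | a where "a \<in> A" "comp (S \<union> A) v \<subseteq> comp F (y a)"
proof (cases "comp (S \<union> A) v \<inter> comp F w = {}")
  case True
  then have "comp (S \<union> A) v \<subseteq> comp S v" by (rule comp_star_outside)
  also have "\<dots> \<subseteq> comp F v" using assms(1) by (auto elim: conn_mono)
  finally have sub: "comp (S \<union> A) v \<subseteq> comp F v" .
  have "v \<in> comp (S \<union> A) v" by simp
  with True have "v \<notin> comp F w" by blast
  then obtain a where a: "a \<in> A" "conn F (y a) v" using assms(2) unfolding zone_def by auto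
  then have "comp F (y a) = comp F v" by (simp add: comp_eq_iff)
  with a(1) sub show thesis using that(2) by blast
next
  case False
  then obtain p where "conn (S \<union> A) v p" "p \<in> comp F w" by auto
  then show thesis using that(1) comp_eq_iff by blast
qed

text \<open>A piece of the centre contains at most one tail, so it takes up at most one
  leaf.\<close>

lemma comp_separated:
  assumes "S \<subseteq> F" "p \<in> comp F w"
    and sep: "\<And>a a'. a \<in> A \<Longrightarrow> a' \<in> A \<Longrightarrow> a \<noteq> a' \<Longrightarrow> \<not> conn S (x a) (x a')"
  obtains "comp (S \<union> A) p \<subseteq> comp S p"
  | a where "a \<in> A" "conn S p (x a)" "comp (S \<union> A) p \<subseteq> comp S p \<union> comp F (y a)"
proof (cases "\<exists>a\<in>A. conn S p (x a)")
  case True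
  then obtain a where a: "a \<in> A" "conn S p (x a)" by blast
  have "a' = a" if "a' \<in> A" "conn S p (x a')" for a'
    using sep[OF that(1) a(1)] that(2) a(2) by (meson conn_sym conn_trans)
  then have "{a' \<in> A. conn S p (x a')} = {a}" using a by blast
  then show thesis
    using that(2)[OF a] comp_star[OF assms(1) order_refl, of p] assms(2) by simp
next
  case False
  then have eq: "{a' \<in> A. conn S p (x a')} = {}" by blast
  show thesis
    using that(1) comp_star[OF assms(1) order_refl, of p] assms(2) unfolding eq by simp
qed

end

section \<open>Extremal decompositions\<close>

lemma lex_less_thanI:
  assumes "length xs = length ys" "m < length xs" "\<And>j. j < m \<Longrightarrow> xs ! j = ys ! j" "xs ! m < ys ! m"
  shows "(xs, ys) \<in> lex less_than"
proof -
  have "take m xs = take m ys" using assms by (intro nth_take_lemma) auto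
  then have "xs = take m xs @ xs ! m # drop (Suc m) xs" "ys = take m xs @ ys ! m # drop (Suc m) ys"
    using assms(1,2) id_take_nth_drop[of m xs] id_take_nth_drop[of m ys] by auto
  then show ?thesis using assms(1,4) unfolding lex_conv by blast
qed

text \<open>\<open>Q\<close> gives the partition of the vertices into the classes that each of the
  \<open>k\<close> non-red forests spans; it stays fixed while the forests vary.\<close>

locale tight_graph = edge_ends en for en :: "'e \<Rightarrow> 'v set" +
  fixes V :: "'v set" and E :: "'e set" and k :: nat and Q :: "'v \<Rightarrow> 'v \<Rightarrow> bool"
  assumes finite_V: "finite V" and equivp_Q: "equivp Q"
    and edges_Q: "e \<in> E \<Longrightarrow> en e = {u, v} \<Longrightarrow> Q u v"
    and edges_V: "e \<in> E \<Longrightarrow> en e \<subseteq> V"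
begin

definition cfg :: "(nat \<Rightarrow> 'e set) \<Rightarrow> 'e set \<Rightarrow> bool" where
  "cfg T F \<longleftrightarrow> (\<forall>b<k. forest (T b) \<and> conn (T b) = Q) \<and> forest F
    \<and> (\<forall>h. mult T k h + of_bool (h \<in> F) = of_bool (h \<in> E))"

definition bounded :: "nat \<Rightarrow> 'e set \<Rightarrow> bool" where
  "bounded M F \<longleftrightarrow> (\<forall>v\<in>V. card (comp F v) \<le> M)"

definition big :: "nat \<Rightarrow> 'e set \<Rightarrow> 'v set" where
  "big M F = {v \<in> V. card (comp F v) = M}"

text \<open>
  The padding exceeds every component, so that extending a legal list makes it lexicographically
  smaller.
\<close>

definition sizes :: "nat \<Rightarrow> 'e set \<Rightarrow> 'v list \<Rightarrow> nat list" where
  "sizes M F ws = map (\<lambda>j. if j < length ws then card (comp F (ws ! j)) else Suc M) [0..<card V]"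

lemma cfgD:
  assumes "cfg T F"
  shows "b < k \<Longrightarrow> forest (T b)" "b < k \<Longrightarrow> conn (T b) = Q" "forest F"
    "mult T k h + of_bool (h \<in> F) = of_bool (h \<in> E)"
    "b < k \<Longrightarrow> T b \<subseteq> E" "F \<subseteq> E" "b < k \<Longrightarrow> T b \<inter> F = {}"
proof -
  have m: "mult T k h + of_bool (h \<in> F) = of_bool (h \<in> E)" for h using assms unfolding cfg_def by blast
  show "mult T k h + of_bool (h \<in> F) = of_bool (h \<in> E)" by (rule m)
  show "F \<subseteq> E"
  proof
    fix h assume "h \<in> F"
    with m[of h] show "h \<in> E" by (cases "h \<in> E") auto
  qed
  show "T b \<subseteq> E" if b: "b < k"
  proof
    fix h assume "h \<in> T b"
    with mult_pos[of b k h T, OF b this] m[of h] show "h \<in> E" by (cases "h \<in> E") auto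
  qed
  show "T b \<inter> F = {}" if b: "b < k"
  proof (rule ccontr)
    assume "T b \<inter> F \<noteq> {}"
    then obtain h where h: "h \<in> T b" "h \<in> F" by blast
    from mult_pos[of b k h T, OF b h(1)] m[of h] h(2) show False by (cases "h \<in> E") auto
  qed
qed (use assms in \<open>auto simp: cfg_def\<close>)

lemma red_Q: "cfg T F \<Longrightarrow> conn F u v \<Longrightarrow> Q u v"
  by (rule conn_least[OF _ equivp_Q]) (use edges_Q cfgD(6) in blast)+

lemma red_comp_V: "cfg T F \<Longrightarrow> v \<in> V \<Longrightarrow> comp F v \<subseteq> V"
  using edges_V cfgD(6) by (intro comp_subset) blast+

lemma legal_nth_in_V:
  assumes "cfg T F" "legal T k F r ws" "r \<in> V" "j < length ws"
  shows "ws ! j \<in> V"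
proof (cases j)
  case 0
  then show ?thesis using legalD(2)[OF assms(2)] assms(3) by simp
next
  case (Suc j')
  then obtain l b u e where e: "b < k" "arc (T b) r u e (ws ! j)"
    using legal_parentE[OF assms(2) _ assms(4)] by blast
  then have "e \<in> E" "ws ! j \<in> en e" using cfgD(5)[OF assms(1)] unfolding arc_def by auto
  then show ?thesis using edges_V by blast
qed

text \<open>\<open>lex\<close> compares lists of equal length, so \<open>sizes\<close> always has
  length \<open>card V\<close>; by this bound it cuts off no entry of a legal list.\<close>

lemma legal_length:
  assumes "cfg T F" "legal T k F r ws" "r \<in> V"
  shows "length ws \<le> card V"
proof -
  have "ws ! l \<noteq> ws ! j" if "l < j" "j < length ws" for l j
    using legalD(4)[OF assms(2) that(2,1)] conn_refl[of F "ws ! l"] by metis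
  then have "distinct ws" unfolding distinct_conv_nth by (metis linorder_neqE_nat)
  moreover have "set ws \<subseteq> V" using legal_nth_in_V[OF assms] by (auto simp: in_set_conv_nth)
  ultimately show ?thesis by (metis card_mono distinct_card finite_V)
qed

end

section \<open>Consequences of extremality\<close>

locale extremal = tight_graph en V E k Q
  for en :: "'e \<Rightarrow> 'v set" and V :: "'v set" and E :: "'e set" and k :: nat
    and Q :: "'v \<Rightarrow> 'v \<Rightarrow> bool" +
  fixes M :: nat and T :: "nat \<Rightarrow> 'e set" and F :: "'e set" and r :: 'v and ws :: "'v list"
  assumes cfg: "cfg T F" and bounded: "bounded M F" and legal: "legal T k F r ws"
    and root_V: "r \<in> V" and root_size: "card (comp F r) = M"
    and min_big: "cfg T' F' \<Longrightarrow> bounded M F' \<Longrightarrow> card (big M F) \<le> card (big M F')"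
    and min_sizes: "cfg T' F' \<Longrightarrow> bounded M F' \<Longrightarrow> card (big M F') = card (big M F) \<Longrightarrow>
      card (comp F' r) = M \<Longrightarrow> legal T' k F' r ws' \<Longrightarrow> (sizes M F' ws', sizes M F ws) \<notin> lex less_than"
begin

lemmas forest_F = cfgD(3)[OF cfg] and forest_T = cfgD(1)[OF cfg] and conn_T = cfgD(2)[OF cfg]

text \<open>The lists may be compared only while the component of the root has size
  \<open>M\<close>. If the root component itself shrinks (\<open>m = 0\<close>), the number of
  vertices in components of size \<open>M\<close> must drop instead.\<close>

lemma no_descent:
  assumes "cfg T' F'" "bounded M F'" "m < length ws" "legal T' k F' r (take (Suc m) ws)"
    and "\<And>j. j < m \<Longrightarrow> card (comp F' (ws ! j)) = card (comp F (ws ! j))"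
    and "card (comp F' (ws ! m)) < card (comp F (ws ! m))"
    and "card (big M F') \<le> card (big M F)" "m = 0 \<Longrightarrow> card (big M F') < card (big M F)"
  shows False
proof (cases "m = 0")
  case True
  then show False using assms(8) min_big[OF assms(1,2)] by simp
next
  case False
  have r: "card (comp F' r) = M"
    using assms(5)[of 0] False legalD(2)[OF legal] root_size by simp
  have eq: "card (big M F') = card (big M F)" using assms(7) min_big[OF assms(1,2)] by simp
  have "m < card V" using legal_length[OF cfg legal root_V] assms(3) by simp
  then have "(sizes M F' (take (Suc m) ws), sizes M F ws) \<in> lex less_than"
    using assms(3,5,6) by (intro lex_less_thanI[of _ _ m]) (auto simp: sizes_def)
  with min_sizes[OF assms(1,2) eq r assms(4)] show False ..
qed

text \<open>Otherwise appending \<open>v\<close> would replace a padding entry \<open>Suc M\<close>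
  by a size at most \<open>M\<close>. Closure under outgoing arcs is what makes every tree span the
  union of the listed components.\<close>

lemma legal_complete:
  assumes "j < length ws" "conn F (ws ! j) u" "b < k" "arc (T b) r u e v"
  shows "\<exists>l<length ws. conn F (ws ! l) v"
proof (rule ccontr)
  assume new: "\<not> ?thesis"
  let ?ws = "ws @ [v]"
  have leg: "legal T k F r ?ws"
    unfolding legal_def
  proof (intro conjI allI impI)
    show "?ws ! 0 = r" using legalD(2,3)[OF legal] by (simp add: nth_append)
    fix j' assume j': "0 < j' \<and> j' < length ?ws"
    show "\<exists>l<j'. \<exists>b<k. \<exists>u e. conn F (?ws ! l) u \<and> arc (T b) r u e (?ws ! j')"
    proof (cases "j' = length ws")
      case True
      then show ?thesis using assms
        by (intro exI[of _ j] conjI exI[of _ b] exI[of _ u] exI[of _ e]) (auto simp: nth_append)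
    next
      case False
      then have lt: "j' < length ws" using j' by simp
      from j' have "0 < j'" by simp
      then obtain l c u e where "l < j'" "c < k" "conn F (ws ! l) u" "arc (T c) r u e (ws ! j')"
        using legal_parentE[OF legal _ lt] by blast
      then show ?thesis using lt
        by (intro exI[of _ l] conjI exI[of _ c] exI[of _ u] exI[of _ e]) (auto simp: nth_append)
    qed
  next
    fix j' l assume j': "j' < length ?ws" "l < j'"
    show "\<not> conn F (?ws ! l) (?ws ! j')"
    proof (cases "j' = length ws")
      case True
      then show ?thesis using new j'(2) by (auto simp: nth_append)
    next
      case False
      then show ?thesis using legalD(4)[OF legal, of j' l] j' by (auto simp: nth_append)
    qed
  qed simp
  have len: "length ws < card V" using legal_length[OF cfg leg root_V] by simp
  have "v \<in> V" using legal_nth_in_V[OF cfg leg root_V, of "length ws"] by simp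
  then have "card (comp F v) < Suc M" using bounded unfolding bounded_def by auto
  then have "(sizes M F ?ws, sizes M F ws) \<in> lex less_than"
    using len by (intro lex_less_thanI[of _ _ "length ws"]) (auto simp: sizes_def nth_append)
  with min_sizes[OF cfg bounded refl root_size leg] show False ..
qed

text \<open>
  Here \<open>c = 0\<close> gives the lower bound for a component and its successor. For \<open>c > 0\<close>, besides the
  red edge ending the exchange chain, \<open>c\<close> red edges separating the tails of the \<open>c + 1\<close> arcs
  are moved to the spanning tree.
\<close>

lemma no_cheap_arcs:
  fixes x y :: "'e \<Rightarrow> 'v"
  assumes i: "i < length ws" and b: "b < k" and A: "A \<subseteq> T b" "card A = Suc c" "c \<le> 2"
    and arcs: "\<And>a. a \<in> A \<Longrightarrow> arc (T b) r (x a) a (y a)" "\<And>a. a \<in> A \<Longrightarrow> conn F (ws ! i) (x a)"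
    and new: "\<And>a l. a \<in> A \<Longrightarrow> l \<le> i \<Longrightarrow> \<not> conn F (ws ! l) (y a)"
    and dist: "\<And>a a'. a \<in> A \<Longrightarrow> a' \<in> A \<Longrightarrow> conn F (y a) (y a') \<Longrightarrow> a = a'"
    and cheap: "c = 0 \<and> (\<forall>a\<in>A. card (comp F (ws ! i)) + card (comp F (y a)) < M)
      \<or> 0 < c \<and> 2 * c < M \<and> (\<forall>a\<in>A. card (comp F (y a)) \<le> c)"
  shows False
proof -
  let ?K = "comp F (ws ! i)"
  let ?S = "T b - A"
  have finA: "finite A" using A(2) by (simp add: card_ge_0_finite)
  have ends: "en a = {x a, y a}" if "a \<in> A" for a using arcs(1)[OF that] unfolding arc_def by blast
  have KV: "?K \<subseteq> V" using red_comp_V[OF cfg legal_nth_in_V[OF cfg legal root_V i]] .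
  have finC: "finite (comp F' v)" if "forest F'" for F' v using finite_comp that by blast
  have KM: "card ?K \<le> M"
    using bounded legal_nth_in_V[OF cfg legal root_V i] unfolding bounded_def by blast
  have cut: "\<not> conn ?S (x a) r" if "a \<in> A" for a
  proof
    assume "conn ?S (x a) r"
    then have "conn (T b - {a}) (x a) r" by (rule conn_mono) (use that in blast)
    with arc_tail_cut[OF forest_T[OF b] arcs(1)[OF that]] show False ..
  qed
  have sepS: "\<not> conn ?S (x a) (x a')" if "a \<in> A" "a' \<in> A" "a \<noteq> a'" for a a'
    using arcs_cut[OF forest_T[OF b] arcs(1)[OF that(1)] arcs(1)[OF that(2)] that(3,1,2)] .
  have inj: "inj_on x A" using sepS by (metis conn_refl inj_onI)
  have cX: "card (x ` A) = Suc c" using inj A(2) by (simp add: card_image)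
  define Sep where "Sep = (\<lambda>B. B \<subseteq> F \<and> card B = c \<and> (\<forall>f\<in>B. en f \<subseteq> ?K)
    \<and> (\<forall>u\<in>x ` A. \<forall>v\<in>x ` A. u \<noteq> v \<longrightarrow> \<not> conn (F - B) u v))"
  have HB: "\<exists>B. Sep B \<and> g \<notin> B \<and> B \<inter> ?S = {} \<and> forest (insert g ?S \<union> B)
      \<and> conn (insert g ?S \<union> B) = Q"
    if g: "en g = {u, v}" "conn ?S u r" "\<not> conn ?S v r" "Q u v" for g u v
  proof -
    have nuv: "\<not> conn ?S u v" using g(2,3) by (meson conn_sym conn_trans)
    have gS: "g \<notin> ?S" using nuv g(1) conn_edge by blast
    have foS: "forest ?S" using forest_T[OF b] forest_subset by blast
    have fo: "forest (insert g ?S)" using forest_insert[OF foS g(1) nuv] .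
    have n: "\<not> conn (insert g ?S) s t" if st: "s \<in> x ` A" "t \<in> x ` A" "s \<noteq> t" for s t
    proof
      assume c: "conn (insert g ?S) s t"
      have "\<not> conn ?S s r" "\<not> conn ?S t r" "\<not> conn ?S s t" using st cut sepS by auto
      then show False using conn_insert_split[OF c g(1)] g(2) by (meson conn_sym conn_trans)
    qed
    have XK: "x ` A \<subseteq> ?K" using arcs(2) by auto
    obtain B where B: "B \<subseteq> F" "card B + 1 = card (x ` A)" "B \<inter> insert g ?S = {}"
      "forest (insert g ?S \<union> B)" "\<forall>f\<in>B. en f \<subseteq> ?K"
      "\<forall>u\<in>x ` A. \<forall>v\<in>x ` A. u \<noteq> v \<longrightarrow> \<not> conn (F - B) u v"
      using separator[OF forest_F fo XK n] cX A(3) by auto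
    have finS: "finite ?S" using foS forest_finite by blast
    \<comment> \<open>The tree loses \<open>Suc c\<close> arcs and gains \<open>g\<close> and the
      \<open>c\<close> edges of \<open>B\<close>; it is acyclic and joins only
      \<open>Q\<close>-related vertices, so counting shows that it spans.\<close>
    have "conn (insert g ?S \<union> B) = conn (T b)"
    proof (rule forest_spanning[OF B(4) forest_T[OF b]])
      fix s t assume "conn (insert g ?S \<union> B) s t"
      then have "Q s t"
      proof (rule conn_least[OF _ equivp_Q])
        fix e s t assume e: "e \<in> insert g ?S \<union> B" "en e = {s, t}"
        show "Q s t"
        proof (cases "e = g")
          case True
          then show ?thesis using e(2) g(1,4) equivp_symp[OF equivp_Q]
            by (auto simp: doubleton_eq_iff)
        next
          case False
          then have "e \<in> E" using e(1) B(1) cfgD(5,6)[OF cfg] b by blast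
          then show ?thesis using e(2) edges_Q by blast
        qed
      qed
      then show "conn (T b) s t" using conn_T[OF b] by simp
    next
      have "finite B" using B(1) forest_F forest_finite finite_subset by blast
      then have "card (insert g ?S \<union> B) = card (insert g ?S) + card B"
        using B(3) finS by (intro card_Un_disjoint) auto
      also have "card (insert g ?S) = Suc (card ?S)" using gS finS by simp
      also have "card ?S = card (T b) - Suc c" using A(1,2) finA by (simp add: card_Diff_subset)
      finally have "card (insert g ?S \<union> B) = Suc (card (T b) - Suc c) + card B" .
      moreover have "Suc c \<le> card (T b)"
        using card_mono[OF forest_finite[OF forest_T[OF b]] A(1)] A(2) by simp
      ultimately show "card (insert g ?S \<union> B) = card (T b)" using B(2) cX by simp
    qed
    then show ?thesis
      using B cX conn_T[OF b] unfolding Sep_def by (intro exI[of _ B]) auto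
  qed
  obtain a0 where a0: "a0 \<in> A" using A(2) by (metis card.empty ex_in_conv nat.distinct(1))
  have chain: "\<exists>T' m f B. m \<le> i \<and> f \<in> F \<and> en f \<subseteq> comp F (ws ! m) \<and> Sep B
    \<and> (\<forall>b<k. forest (T' b) \<and> conn (T' b) = Q)
    \<and> (\<forall>h. mult T' k h + of_bool (h \<in> A) = mult T k h + of_bool (h \<in> B) + of_bool (h = f))
    \<and> legal T' k F r (take (Suc m) ws)
    \<and> (m = i \<longrightarrow> f \<notin> B \<and> \<not> conn (F - {f}) (ws ! i) (x a0))"
    by (rule exchange_chain[OF forest_F _ _ _ legal i b A(1) a0 arcs(1)[OF a0] arcs(2)[OF a0]])
      (fact red_Q[OF cfg] forest_T conn_T HB)+
  obtain T' m f B where mi: "m \<le> i" and f: "f \<in> F" "en f \<subseteq> comp F (ws ! m)" and "Sep B"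
    and T': "\<forall>b<k. forest (T' b) \<and> conn (T' b) = Q"
    and mult: "\<And>h. mult T' k h + of_bool (h \<in> A) = mult T k h + of_bool (h \<in> B) + of_bool (h = f)"
    and leg': "legal T' k F r (take (Suc m) ws)"
    and mi': "m = i \<Longrightarrow> f \<notin> B \<and> \<not> conn (F - {f}) (ws ! i) (x a0)"
    using chain by blast
  have B: "B \<subseteq> F" "card B = c" "\<And>f. f \<in> B \<Longrightarrow> en f \<subseteq> ?K"
    "\<And>u v. u \<in> x ` A \<Longrightarrow> v \<in> x ` A \<Longrightarrow> u \<noteq> v \<Longrightarrow> \<not> conn (F - B) u v"
    using \<open>Sep B\<close> unfolding Sep_def by blast+
  have mlen: "m < length ws" using mi i by simp
  have sepw: "\<not> conn F (ws ! l) (ws ! j)" if "l < j" "j \<le> i" for l j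
    using legalD(4)[OF legal, of j l] that i by simp
  have fB: "f \<notin> B"
  proof (cases "m = i")
    case False
    show ?thesis
    proof
      assume "f \<in> B"
      then have "en f \<subseteq> ?K" using B(3) by blast
      moreover obtain s t where "en f = {s, t}" using forest_endsE[OF forest_F f(1)] by blast
      ultimately have "conn F (ws ! m) s" "conn F (ws ! i) s" using f(2) by auto
      then have "conn F (ws ! m) (ws ! i)" by (meson conn_sym conn_trans)
      with sepw[of m i] mi False show False by simp
    qed
  qed (use mi' in blast)
  define S where "S = F - insert f B"
  define F' where "F' = S \<union> A"
  have SF: "S \<subseteq> F" unfolding S_def by blast
  have forS: "forest S" using forest_F SF by (rule forest_subset)
  have AF: "A \<inter> F = {}" using cfgD(7)[OF cfg b] A(1) by blast
  interpret st: star en F A "ws ! i" x y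
  proof
    show "\<not> conn F (ws ! i) (y a)" if "a \<in> A" for a using new that by blast
  qed (use forest_F finA ends arcs(2) dist in auto)
  have forF': "forest F'" using st.forest_star by (rule forest_subset) (use SF in \<open>auto simp: F'_def\<close>)
  have cfg': "cfg T' F'"
    unfolding cfg_def
  proof (intro conjI allI)
    fix h
    show "mult T' k h + of_bool (h \<in> F') = of_bool (h \<in> E)"
      using mult[of h] cfgD(4)[OF cfg, of h] fB f(1) B(1) AF unfolding F'_def S_def
      by (cases "h \<in> A"; cases "h \<in> B"; cases "h = f"; cases "h \<in> F") auto
  qed (use T' forF' in auto)
  have sepA: "\<not> conn S (x a) (x a')" if "a \<in> A" "a' \<in> A" "a \<noteq> a'" for a a'
  proof
    assume "conn S (x a) (x a')"
    then have "conn (F - B) (x a) (x a')" by (rule conn_mono) (auto simp: S_def)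
    with B(4)[of "x a" "x a'"] that inj show False by (auto simp: inj_on_def)
  qed
  \<comment> \<open>Every removed edge of \<open>?K\<close> costs each piece at least one vertex:
    \<open>c\<close> for \<open>B\<close>, and one more if \<open>f\<close> lies in
    \<open>?K\<close> too.\<close>
  have SK: "card (comp S p) + c + of_bool (m = i) \<le> card ?K" if p: "p \<in> ?K" for p
  proof -
    have cp: "comp F p = ?K" using p comp_eq_iff[of F "ws ! i" p] by simp
    let ?R = "if m = i then insert f B else B"
    have "card (comp (F - ?R) p) + card ?R \<le> card (comp F p)"
      using B(1,3) f cp by (intro card_comp_Diff[OF forest_F]) (auto split: if_splits)
    moreover have "card ?R = c + of_bool (m = i)"
      using B(1,2) fB finite_subset[OF B(1) forest_finite[OF forest_F]] by simp
    moreover have "comp S p \<subseteq> comp (F - ?R) p"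
    proof
      fix z assume "z \<in> comp S p"
      then have "conn S p z" by simp
      then have "conn (F - ?R) p z" by (rule conn_mono) (auto simp: S_def)
      then show "z \<in> comp (F - ?R) p" by simp
    qed
    then have "card (comp S p) \<le> card (comp (F - ?R) p)"
      using finC[OF forest_subset[OF forest_F]] by (intro card_mono) auto
    ultimately show ?thesis using cp by simp
  qed
  \<comment> \<open>For \<open>c > 0\<close> the \<open>c\<close> vertices lost in the centre make
    up for one leaf of at most \<open>c\<close> vertices; for \<open>c = 0\<close> centre and leaf
    together stay below \<open>M\<close> by hypothesis.\<close>
  have KF': "card (comp F' p) \<le> M \<and> (c = 0 \<or> m = i \<or> card ?K < M \<longrightarrow> card (comp F' p) < M)
      \<and> (0 < c \<longrightarrow> card (comp F' p) + of_bool (m = i) \<le> card ?K)" if p: "p \<in> ?K" for p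
  proof (rule st.comp_separated[OF SF p sepA])
    assume "comp (S \<union> A) p \<subseteq> comp S p"
    then have "card (comp F' p) \<le> card (comp S p)"
      unfolding F'_def using finC[OF forS] by (intro card_mono)
    moreover have "card ?K < M" if "c = 0" using cheap that a0 by auto
    ultimately show ?thesis using SK[OF p] KM by (auto split: if_splits)
  next
    fix a assume a: "a \<in> A" "comp (S \<union> A) p \<subseteq> comp S p \<union> comp F (y a)"
    have "card (comp F' p) \<le> card (comp S p \<union> comp F (y a))"
      unfolding F'_def using a(2) finC[OF forS] finC[OF forest_F] by (intro card_mono) auto
    also have "\<dots> \<le> card (comp S p) + card (comp F (y a))" by (rule card_Un_le)
    finally show ?thesis using SK[OF p] KM cheap a(1) by (auto split: if_splits)
  qed
  have outside: "comp F' v \<subseteq> comp S v" "card (comp F' v) \<le> card (comp F v)" if v: "v \<notin> st.zone" for v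
  proof -
    show sub: "comp F' v \<subseteq> comp S v" unfolding F'_def by (rule st.comp_outside_zone[OF SF v])
    also have "\<dots> \<subseteq> comp F v" using SF by (auto elim: conn_mono)
    finally show "card (comp F' v) \<le> card (comp F v)" using finC[OF forest_F] by (rule card_mono[rotated])
  qed
  have leaf: "0 < c \<and> card (comp F' v) \<le> c \<or> c = 0 \<and> card (comp F' v) < M"
    if "a \<in> A" "comp (S \<union> A) v \<subseteq> comp F (y a)" for v a
  proof -
    have "card (comp F' v) \<le> card (comp F (y a))"
      unfolding F'_def using that(2) finC[OF forest_F] by (rule card_mono[rotated])
    with cheap that(1) show ?thesis by auto
  qed
  have bounded': "bounded M F'"
    unfolding bounded_def
  proof
    fix v assume v: "v \<in> V"
    show "card (comp F' v) \<le> M"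
    proof (cases "v \<in> st.zone")
      case True
      from SF this show ?thesis
      proof (rule st.comp_in_zone)
        fix p assume "p \<in> ?K" "comp (S \<union> A) v = comp (S \<union> A) p"
        then show ?thesis using KF' unfolding F'_def by metis
      next
        fix a assume "a \<in> A" "comp (S \<union> A) v \<subseteq> comp F (y a)"
        from leaf[OF this] show ?thesis using cheap by auto
      qed
    next
      case False
      then show ?thesis using outside(2)[OF False] bounded v unfolding bounded_def
        by (meson order_trans)
    qed
  qed
  have zone: "ws ! j \<notin> st.zone" if "j < i" for j
  proof -
    have "\<not> conn F (ws ! i) (ws ! j)" using sepw[of j i] that conn_sym by blast
    moreover have "\<not> conn F (y a) (ws ! j)" if "a \<in> A" for a
      using new[OF that, of j] \<open>j < i\<close> conn_sym by auto
    ultimately show ?thesis unfolding st.zone_def by auto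
  qed
  \<comment> \<open>Edges leave the red forest only in the components of \<open>ws ! m\<close> and
    \<open>ws ! i\<close>, and new ones affect only the zone, which avoids earlier entries.\<close>
  have same: "comp F' (ws ! j) = comp F (ws ! j)" if j: "j < m" for j
  proof
    have ji: "j < i" using j mi by simp
    have "en e \<inter> comp F (ws ! j) = {}" if e: "e \<in> insert f B" for e
    proof -
      have "en e \<subseteq> comp F (ws ! (if e = f then m else i))" using e f(2) B(3) by auto
      then obtain l where l: "j < l" "l \<le> i" "en e \<subseteq> comp F (ws ! l)"
        using j mi ji by (metis order_refl)
      have "\<not> conn F (ws ! l) z" if "conn F (ws ! j) z" for z
        using sepw[OF l(1,2)] that by (meson conn_sym conn_trans)
      with l(3) show ?thesis by auto
    qed
    then have S: "comp S (ws ! j) = comp F (ws ! j)" unfolding S_def by (rule comp_Diff_eq)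
    show "comp F' (ws ! j) \<subseteq> comp F (ws ! j)" using outside(1)[OF zone[OF ji]] S by simp
    have "comp S (ws ! j) \<subseteq> comp F' (ws ! j)" unfolding F'_def by (auto elim: conn_mono)
    then show "comp F (ws ! j) \<subseteq> comp F' (ws ! j)" using S by simp
  qed
  have smaller: "card (comp F' (ws ! m)) < card (comp F (ws ! m))"
  proof (cases "m = i")
    case True
    have wK: "ws ! i \<in> ?K" by simp
    show ?thesis
    proof (cases "c = 0")
      \<comment> \<open>No separating edges compensate for the leaf here, but \<open>f\<close> cuts
        the tail of the only arc off from \<open>ws ! i\<close>, so the leaf hangs on another
        piece.\<close>
      case c0: True
      then have A1: "A = {a0}" using A(2) a0 by (metis card_1_singletonE One_nat_def singletonD)
      have nc: "\<not> conn S (ws ! i) (x a0)"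
      proof
        assume "conn S (ws ! i) (x a0)"
        then have "conn (F - {f}) (ws ! i) (x a0)" by (rule conn_mono) (auto simp: S_def)
        with mi' True show False by blast
      qed
      have "comp (S \<union> A) (ws ! i) \<subseteq> comp S (ws ! i)"
      proof (rule st.comp_separated[OF SF wK sepA])
        fix a assume "a \<in> A" "conn S (ws ! i) (x a)"
        with A1 nc show ?thesis by simp
      qed
      then have "card (comp F' (ws ! i)) \<le> card (comp S (ws ! i))"
        unfolding F'_def using finC[OF forS] by (intro card_mono)
      then show ?thesis using SK[OF wK] True by simp
    next
      case False
      then show ?thesis using KF'[OF wK] True by simp
    qed
  next
    case False
    then have "ws ! m \<notin> st.zone" using zone mi by simp
    then have "comp F' (ws ! m) \<subseteq> comp S (ws ! m)" by (rule outside(1))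
    also have "\<dots> \<subseteq> comp (F - {f}) (ws ! m)" unfolding S_def by (auto elim: conn_mono)
    finally have "card (comp F' (ws ! m)) \<le> card (comp (F - {f}) (ws ! m))"
      using finC[OF forest_subset[OF forest_F]] by (intro card_mono) auto
    moreover have "card (comp (F - {f}) (ws ! m)) + card {f} \<le> card (comp F (ws ! m))"
      using f by (intro card_comp_Diff[OF forest_F]) auto
    ultimately show ?thesis by simp
  qed
  have leg: "legal T' k F' r (take (Suc m) ws)"
    unfolding legal_def
  proof (intro conjI allI impI)
    show "take (Suc m) ws \<noteq> []" "take (Suc m) ws ! 0 = r" using legalD(1,2)[OF leg'] .
    have cc: "conn F' (ws ! l) u \<longleftrightarrow> conn F (ws ! l) u" if "l < m" for l u
      using same[OF that] by (metis mem_comp)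
    fix j assume j: "j < length (take (Suc m) ws)"
    show "\<not> conn F' (take (Suc m) ws ! l) (take (Suc m) ws ! j)" if "l < j" for l
    proof -
      have "l < m" using that j by simp
      with cc[OF this] legalD(4)[OF leg' j that] that j show ?thesis by simp
    qed
  next
    fix j assume j: "0 < j \<and> j < length (take (Suc m) ws)"
    then have j': "0 < j" "j < length (take (Suc m) ws)" by auto
    obtain l b u e where e: "l < j" "b < k" "conn F (take (Suc m) ws ! l) u"
      "arc (T' b) r u e (take (Suc m) ws ! j)"
      using legal_parentE[OF leg' j'] by blast
    have "l < m" using e(1) j by simp
    then have "conn F' (take (Suc m) ws ! l) u" using e(3) same by (metis mem_comp less_SucI nth_take)
    with e show "\<exists>l<j. \<exists>b<k. \<exists>u e. conn F' (take (Suc m) ws ! l) u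
        \<and> arc (T' b) r u e (take (Suc m) ws ! j)" by blast
  qed
  have root: "r \<in> big M F" using root_V root_size unfolding big_def by simp
  have root': "r \<notin> big M F'" if "m = 0"
    using smaller root_size legalD(2)[OF legal] that unfolding big_def by simp
  have finV: "finite (big N G)" for N G using finite_V unfolding big_def by simp
  have out_sub: "big M F' - st.zone \<subseteq> big M F - st.zone"
  proof
    fix v assume v: "v \<in> big M F' - st.zone"
    then have "v \<in> V" "M \<le> card (comp F v)" using outside(2)[of v] unfolding big_def by auto
    then show "v \<in> big M F - st.zone" using bounded v unfolding big_def bounded_def by fastforce
  qed
  have "card (big M F') \<le> card (big M F) \<and> (m = 0 \<longrightarrow> card (big M F') < card (big M F))"
  proof (cases "c = 0 \<or> m = i \<or> card ?K < M")
    case True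
    have "card (comp F' v) < M" if "v \<in> st.zone" for v
      using SF that
    proof (rule st.comp_in_zone)
      fix p assume "p \<in> ?K" "comp (S \<union> A) v = comp (S \<union> A) p"
      then show ?thesis using KF' True unfolding F'_def by metis
    next
      fix a assume "a \<in> A" "comp (S \<union> A) v \<subseteq> comp F (y a)"
      from leaf[OF this] show ?thesis using cheap by auto
    qed
    then have "big M F' \<inter> st.zone = {}" unfolding big_def by fastforce
    then have sub: "big M F' \<subseteq> big M F" using out_sub by blast
    then show ?thesis using root root' finV by (metis card_mono psubsetI psubset_card_mono)
  next
    case False
    then have c: "0 < c" "2 * c < M" "\<forall>a\<in>A. card (comp F (y a)) \<le> c" "m < i" "card ?K = M"
      using cheap KM mi by auto
    have Kbig: "?K \<subseteq> big M F \<inter> st.zone"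
    proof
      fix v assume v: "v \<in> ?K"
      then have "comp F v = ?K" using comp_eq_iff[of F "ws ! i" v] by simp
      then show "v \<in> big M F \<inter> st.zone" using v KV c(5) unfolding big_def st.zone_def by auto
    qed
    \<comment> \<open>A new component of size \<open>M\<close> in the zone has at least
      \<open>M - c > M / 2\<close> vertices in \<open>?K\<close>, which has only \<open>M\<close>;
      so there is at most one, and it does no more than replace \<open>?K\<close>.\<close>
    have half: "M \<le> card (comp F' v \<inter> ?K) + c" if v: "v \<in> big M F'" "v \<in> st.zone" for v
    proof (rule st.comp_in_zone[OF SF v(2)])
      fix a assume "a \<in> A" "comp (S \<union> A) v \<subseteq> comp F (y a)"
      from leaf[OF this] show ?thesis using c v(1) unfolding big_def by auto
    next
      fix p assume p: "p \<in> ?K" "comp (S \<union> A) v = comp (S \<union> A) p"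
      have SpK: "comp S p \<subseteq> ?K"
      proof
        fix z assume "z \<in> comp S p"
        then have "conn F p z" using SF conn_mono by simp
        with p(1) show "z \<in> ?K" using conn_trans by simp
      qed
      obtain C where C: "finite C" "card C \<le> c" "comp F' p \<subseteq> comp S p \<union> C"
      proof (rule st.comp_separated[OF SF p(1) sepA])
        assume "comp (S \<union> A) p \<subseteq> comp S p"
        then show thesis using that[of "{}"] unfolding F'_def by simp
      next
        fix a assume "a \<in> A" "comp (S \<union> A) p \<subseteq> comp S p \<union> comp F (y a)"
        then show thesis using that[of "comp F (y a)"] c(3) finC[OF forest_F] unfolding F'_def by simp
      qed
      have "card (comp F' p) \<le> card ((comp F' p \<inter> ?K) \<union> C)"
        using C(1,3) SpK finC[OF forest_F] by (intro card_mono) auto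
      also have "\<dots> \<le> card (comp F' p \<inter> ?K) + card C" by (rule card_Un_le)
      finally have "card (comp F' p) \<le> card (comp F' p \<inter> ?K) + c" using C(2) by simp
      then show ?thesis using v(1) p(2) unfolding big_def F'_def by simp
    qed
    have "card (big M F' \<inter> st.zone) \<le> M"
    proof (cases "big M F' \<inter> st.zone = {}")
      case False
      then obtain v where v: "v \<in> big M F'" "v \<in> st.zone" by blast
      have "big M F' \<inter> st.zone \<subseteq> comp F' v"
      proof
        fix v' assume "v' \<in> big M F' \<inter> st.zone"
        then have v': "v' \<in> big M F'" "v' \<in> st.zone" by auto
        show "v' \<in> comp F' v"
        proof (rule ccontr)
          assume "v' \<notin> comp F' v"
          then have nc: "\<not> conn F' v v'" by simp
          have "(comp F' v \<inter> ?K) \<inter> (comp F' v' \<inter> ?K) = {}"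
          proof (rule ccontr)
            assume "\<not> ?thesis"
            then obtain z where "conn F' v z" "conn F' v' z" by auto
            with nc show False by (meson conn_sym conn_trans)
          qed
          then have "card (comp F' v \<inter> ?K) + card (comp F' v' \<inter> ?K)
              = card ((comp F' v \<inter> ?K) \<union> (comp F' v' \<inter> ?K))"
            using finC[OF forest_F] by (intro card_Un_disjoint[symmetric]) auto
          also have "\<dots> \<le> card ?K" using finC[OF forest_F] by (intro card_mono) auto
          finally show False using half[OF v] half[OF v'] c by linarith
        qed
      qed
      then have "card (big M F' \<inter> st.zone) \<le> card (comp F' v)"
        using finC[OF forF'] by (intro card_mono)
      then show ?thesis using v(1) unfolding big_def by simp
    qed simp
    also have "M \<le> card (big M F \<inter> st.zone)" using card_mono[OF _ Kbig] finV c(5) by simp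
    finally have inside: "card (big M F' \<inter> st.zone) \<le> card (big M F \<inter> st.zone)" .
    have split: "card (big M G) = card (big M G - st.zone) + card (big M G \<inter> st.zone)" for G
      using finV by (subst card_Un_disjoint[symmetric]) (auto simp: Un_Diff_Int)
    have le: "card (big M F' - st.zone) \<le> card (big M F - st.zone)"
      using out_sub finV by (intro card_mono) auto
    have lt: "card (big M F' - st.zone) < card (big M F - st.zone)" if m0: "m = 0"
    proof (rule psubset_card_mono)
      have "r \<notin> st.zone" using zone[of 0] c(4) legalD(2)[OF legal] m0 by simp
      then show "big M F' - st.zone \<subset> big M F - st.zone" using out_sub root root'[OF m0] by blast
    qed (use finV in simp)
    show ?thesis using split[of F] split[of F'] inside le lt by linarith
  qed
  then show False using no_descent[OF cfg' bounded' mlen leg] same smaller by simp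
qed

end

section \<open>Counting\<close>

text \<open>\<open>\<beta> i\<close> bounds the debt of the small successors of \<open>i\<close> in
  one tree. With \<open>k\<close> trees \<open>i\<close> must afford \<open>k\<close> times as much,
  and the surplus at index \<open>0\<close> makes the total positive.\<close>

lemma weight_sum_pos:
  fixes w \<beta> :: "nat \<Rightarrow> int" and par pb :: "nat \<Rightarrow> nat"
  assumes "0 < L" and Sm: "Sm \<subseteq> {0<..<L}"
    and par: "\<And>j. j \<in> Sm \<Longrightarrow> par j < L \<and> par j \<notin> Sm \<and> pb j < k"
    and le: "\<And>i b. i < L \<Longrightarrow> i \<notin> Sm \<Longrightarrow> b < k \<Longrightarrow> - \<beta> i \<le> (\<Sum>j\<in>{j \<in> Sm. par j = i \<and> pb j = b}. w j)"
    and w: "\<And>i. i < L \<Longrightarrow> i \<notin> Sm \<Longrightarrow> int k * \<beta> i \<le> w i" "int k * \<beta> 0 < w 0"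
  shows "0 < (\<Sum>j<L. w j)"
proof -
  let ?N = "{..<L} - Sm"
  have fS: "finite Sm" using Sm finite_subset by blast
  have ch: "(\<Sum>j\<in>{j \<in> Sm. par j = i}. w j) \<ge> - (int k * \<beta> i)" if "i \<in> ?N" for i
  proof -
    have "(\<Sum>j\<in>{j \<in> Sm. par j = i}. w j)
        = (\<Sum>b<k. \<Sum>j\<in>{j' \<in> {j \<in> Sm. par j = i}. pb j' = b}. w j)"
      using fS par by (intro sum.group[symmetric]) auto
    also have "\<dots> \<ge> (\<Sum>b<k. - \<beta> i)"
      using le[of i] that by (intro sum_mono) (simp add: conj_assoc)
    finally show ?thesis by simp
  qed
  have S0: "0 \<in> ?N" using assms(1) Sm by auto
  have "(\<Sum>j<L. w j) = (\<Sum>j\<in>?N. w j) + (\<Sum>j\<in>Sm. w j)"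
    using Sm by (intro sum.subset_diff) auto
  also have "(\<Sum>j\<in>Sm. w j) = (\<Sum>i\<in>?N. \<Sum>j\<in>{j \<in> Sm. par j = i}. w j)"
    using fS par by (intro sum.group[symmetric]) auto
  also have "(\<Sum>j\<in>?N. w j) + \<dots> = (\<Sum>i\<in>?N. w i + (\<Sum>j\<in>{j \<in> Sm. par j = i}. w j))"
    by (simp add: sum.distrib)
  also have "0 < \<dots>"
  proof (rule sum_pos2[OF _ S0])
    show "0 < w 0 + (\<Sum>j\<in>{j \<in> Sm. par j = 0}. w j)" using ch[OF S0] w(2) by linarith
    show "0 \<le> w i + (\<Sum>j\<in>{j \<in> Sm. par j = i}. w j)" if "i \<in> ?N" for i
      using ch[OF that] w(1)[of i] that by simp
  qed simp
  finally show ?thesis .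
qed

text \<open>
  The numbers \<open>n j\<close> are the sizes of the listed components, component \<open>j\<close> being entered from
  component \<open>par j\<close> along an arc of the forest \<open>pb j\<close>.
\<close>

locale component_tree =
  fixes n par pb :: "nat \<Rightarrow> nat" and L k d M :: nat
  assumes L: "0 < L" and root: "n 0 = M" and pos: "0 < n j"
    and par: "0 < j \<Longrightarrow> j < L \<Longrightarrow> par j < j \<and> pb j < k \<and> M \<le> n (par j) + n j"
    and few: "J \<subseteq> {j. 0 < j \<and> j < L \<and> par j = i \<and> pb j = b} \<Longrightarrow> card J = Suc c \<Longrightarrow> 0 < c \<Longrightarrow>
      c \<le> 2 \<Longrightarrow> 2 * c < M \<Longrightarrow> \<exists>j\<in>J. c < n j"
    and dens: "(\<Sum>j<L. (int k + 1) * (int (n j) - 1) - int d) \<le> - int d"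
begin

definition w :: "nat \<Rightarrow> int" where
  "w j = (int k + 1) * (int (n j) - 1) - int d"

definition small :: "nat set" where
  "small = {j. 0 < j \<and> j < L \<and> w j < 0}"

definition kids :: "nat \<Rightarrow> nat \<Rightarrow> nat set" where
  "kids i b = {j \<in> small. par j = i \<and> pb j = b}"

lemma finite_kids: "finite (kids i b)"
  by (rule finite_subset[of _ "{..<L}"]) (auto simp: kids_def small_def)

lemma w_mono:
  assumes "m \<le> n i"
  shows "(int k + 1) * (int m - 1) - int d \<le> w i"
  unfolding w_def using assms by (intro diff_right_mono mult_left_mono) auto

lemma no_balance:
  assumes "\<And>j. j \<in> small \<Longrightarrow> par j \<notin> small"
    and "\<And>i b. i < L \<Longrightarrow> i \<notin> small \<Longrightarrow> b < k \<Longrightarrow> - \<beta> i \<le> (\<Sum>j\<in>kids i b. w j)"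
    and "\<And>i. i < L \<Longrightarrow> i \<notin> small \<Longrightarrow> int k * \<beta> i \<le> w i" "int k * \<beta> 0 < w 0"
  shows False
proof -
  have "0 < (\<Sum>j<L. w j)"
  proof (rule weight_sum_pos[OF L])
    show "par j < L \<and> par j \<notin> small \<and> pb j < k" if "j \<in> small" for j
      using assms(1)[OF that] par[of j] that unfolding small_def by auto
    show "- \<beta> i \<le> (\<Sum>j\<in>{j \<in> small. par j = i \<and> pb j = b}. w j)"
      if "i < L" "i \<notin> small" "b < k" for i b
      using assms(2)[OF that] unfolding kids_def .
  qed (use assms(3,4) in \<open>auto simp: small_def\<close>)
  with dens show False unfolding w_def by simp
qed

lemma kids_sub: "kids i b \<subseteq> {j. 0 < j \<and> j < L \<and> par j = i \<and> pb j = b}"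
  unfolding kids_def small_def by auto

lemma no_two_singletons:
  assumes "2 < M" "J \<subseteq> kids i b" "\<And>j. j \<in> J \<Longrightarrow> n j = 1"
  shows "card J \<le> 1"
proof (rule ccontr)
  assume "\<not> card J \<le> 1"
  then obtain J' where "J' \<subseteq> J" "card J' = Suc 1"
    using obtain_subset_with_card_n[of "Suc 1" J] by auto
  then show False using few[of J' i b 1] assms kids_sub[of i b] by fastforce
qed

lemma no_three_small:
  assumes "4 < M" "\<And>j. j \<in> kids i b \<Longrightarrow> n j \<le> 2"
  shows "card (kids i b) \<le> 2"
proof (rule ccontr)
  assume "\<not> card (kids i b) \<le> 2"
  then obtain J' where "J' \<subseteq> kids i b" "card J' = Suc 2"
    using obtain_subset_with_card_n[of "Suc 2" "kids i b"] by auto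
  then show False using few[of J' i b 2] assms kids_sub[of i b] by fastforce
qed

text \<open>Small components are single vertices of weight \<open>- d\<close>. The predecessor of
  one has at least \<open>d + 1\<close> vertices, hence weight at least \<open>k * d\<close>, enough
  for one such successor in each tree. The root has a vertex more, whence strictness.\<close>

lemma no_large_component_i:
  assumes d: "d \<le> k + 1" and M: "d + 2 \<le> M"
  shows False
proof -
  have small1: "n j = 1" "w j = - int d" "0 < d" if "j \<in> small" for j
  proof -
    have "(int k + 1) * (int (n j) - 1) < int d" using that unfolding small_def w_def by simp
    also have "\<dots> \<le> (int k + 1) * 1" using d by simp
    finally have "int (n j) - 1 < 1" by (rule mult_left_less_imp_less) simp
    then show nj: "n j = 1" using pos[of j] by simp
    then show "w j = - int d" by (simp add: w_def)
    then show "0 < d" using that unfolding small_def by simp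
  qed
  define \<beta> where "\<beta> i = (if i = 0 \<or> (\<exists>b. kids i b \<noteq> {}) then int d else 0)" for i
  show False
  proof (rule no_balance[where \<beta> = \<beta>])
    show "par j \<notin> small" if j: "j \<in> small" for j
    proof
      assume "par j \<in> small"
      then have "n (par j) = 1" "n j = 1" "0 < d" using small1 j by auto
      moreover have "M \<le> n (par j) + n j" using par[of j] j unfolding small_def by simp
      ultimately show False using M by simp
    qed
    show "- \<beta> i \<le> (\<Sum>j\<in>kids i b. w j)" if "i < L" "i \<notin> small" "b < k" for i b
    proof (cases "kids i b = {}")
      case True
      then show ?thesis by (simp add: \<beta>_def)
    next
      case False
      then obtain j where "j \<in> small" unfolding kids_def by blast
      then have "2 < M" using small1(3)[of j] M by simp
      then have c: "card (kids i b) \<le> 1"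
        using small1(1) by (intro no_two_singletons[of "kids i b" i b]) (auto simp: kids_def)
      have "(\<Sum>j\<in>kids i b. w j) = (\<Sum>j\<in>kids i b. - int d)"
        using small1(2) by (intro sum.cong) (auto simp: kids_def)
      also have "\<dots> = - (int (card (kids i b)) * int d)" by simp
      also have "\<dots> \<ge> - (1 * int d)" using c by (intro le_imp_neg_le mult_right_mono) auto
      finally show ?thesis using False unfolding \<beta>_def by auto
    qed
    show "int k * \<beta> 0 < w 0"
    proof -
      have "int k * int d < (int k + 1) * (int (d + 2) - 1) - int d" by (simp add: algebra_simps)
      also have "\<dots> \<le> w 0" using M root by (intro w_mono) simp
      finally show ?thesis by (simp add: \<beta>_def)
    qed
    then show "int k * \<beta> i \<le> w i" if i: "i < L" "i \<notin> small" for i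
    proof (cases "i = 0")
      case False
      show ?thesis
      proof (cases "\<exists>b. kids i b \<noteq> {}")
        case True
        then obtain j where j: "j \<in> small" "par j = i" unfolding kids_def by blast
        then have "d + 1 \<le> n i" using par[of j] small1(1)[OF j(1)] M unfolding small_def by simp
        then have "(int k + 1) * (int (d + 1) - 1) - int d \<le> w i" by (rule w_mono)
        then show ?thesis using True by (simp add: \<beta>_def algebra_simps)
      next
        case False
        then show ?thesis using i \<open>i \<noteq> 0\<close> unfolding \<beta>_def small_def by simp
      qed
    qed simp
  qed
qed

text \<open>Small components have one vertex and weight \<open>- d\<close>, or two and weight
  \<open>- g\<close>. One tree gives a component at most two of them and not two single vertices, so
  the debt is at most \<open>d + g\<close>, or \<open>2 * g\<close> without single vertices. The
  hypothesis on \<open>D\<close> is equivalent to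
  \<open>k * (d + g) \<le> (k + 1) * D - d\<close>.\<close>

lemma no_large_component_ii:
  assumes d: "k + 1 < d" "d \<le> 2 * (k + 1)"
    and D: "(k + 1) * d + k * d \<le> (k + 1) * D + k * (k + 1)" and M: "D + 2 \<le> M"
  shows False
proof -
  define g where "g = int d - int k - 1"
  have g: "0 < g" "g \<le> int d" using d(1) by (auto simp: g_def)
  have kD: "int k * (int d + g) \<le> (int k + 1) * int D - int d"
  proof -
    have "int ((k + 1) * d + k * d) \<le> int ((k + 1) * D + k * (k + 1))" using D by (rule of_nat_mono)
    then show ?thesis by (simp add: g_def algebra_simps)
  qed
  have small2: "n j \<le> 2" "n j = 1 \<and> w j = - int d \<or> n j = 2 \<and> w j = - g" "0 < k"
    if j: "j \<in> small" for j
  proof -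
    have "(int k + 1) * (int (n j) - 1) < int d" using j unfolding small_def w_def by simp
    also have "\<dots> \<le> (int k + 1) * 2" using d(2) by simp
    finally have "int (n j) - 1 < 2" by (rule mult_left_less_imp_less) simp
    then show n2: "n j \<le> 2" by simp
    then have "n j = 1 \<or> n j = 2" using pos[of j] by linarith
    then show "n j = 1 \<and> w j = - int d \<or> n j = 2 \<and> w j = - g" by (auto simp: w_def g_def)
    show "0 < k" using par[of j] j unfolding small_def by simp
  qed
  have M4: "4 < M" if "0 < k"
  proof -
    have "k * (k + 1) \<le> k * d" using d(1) by (intro mult_left_mono) auto
    then have "(k + 1) * d \<le> (k + 1) * D" using D by linarith
    then have "d \<le> D" by (rule mult_left_le_imp_le) simp
    then show ?thesis using d(1) M that by linarith
  qed
  \<comment> \<open>The root is always assigned the larger debt; its size \<open>M\<close> covers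
    that strictly.\<close>
  define one where "one i \<longleftrightarrow> i = 0 \<or> (\<exists>j\<in>small. par j = i \<and> n j = 1)" for i
  define \<beta> where "\<beta> i = (if one i then int d + g else if \<exists>b. kids i b \<noteq> {} then 2 * g else 0)" for i
  show False
  proof (rule no_balance[where \<beta> = \<beta>])
    show "par j \<notin> small" if j: "j \<in> small" for j
    proof
      assume "par j \<in> small"
      then have "n (par j) \<le> 2" "n j \<le> 2" "4 < M" using small2 j M4 by auto
      moreover have "M \<le> n (par j) + n j" using par[of j] j unfolding small_def by simp
      ultimately show False by simp
    qed
    show "- \<beta> i \<le> (\<Sum>j\<in>kids i b. w j)" if "i < L" "i \<notin> small" "b < k" for i b
    proof -
      have M4: "4 < M" using M4 that(3) by simp
      have ws: "n j = 1 \<and> w j = - int d \<or> n j = 2 \<and> w j = - g" if "j \<in> kids i b" for j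
        using small2(2)[of j] that unfolding kids_def by blast
      have ones: "one i" if "j \<in> kids i b" "n j = 1" for j
        using that unfolding one_def kids_def by blast
      have "card (kids i b) \<le> 2"
        using small2(1) by (intro no_three_small[OF M4]) (auto simp: kids_def)
      then consider "card (kids i b) = 0" | "card (kids i b) = 1" | "card (kids i b) = 2" by linarith
      then show ?thesis
      proof cases
        case 1
        then have "kids i b = {}" using finite_kids by simp
        then show ?thesis using g by (simp add: \<beta>_def)
      next
        case 2
        then obtain j where j: "kids i b = {j}" by (rule card_1_singletonE)
        then have "kids i b \<noteq> {}" by simp
        then have "\<beta> i = int d + g \<or> \<not> one i \<and> \<beta> i = 2 * g" unfolding \<beta>_def by auto
        then show ?thesis using ws[of j] ones[of j] g j by auto
      next
        case 3
        then obtain j j' where j: "kids i b = {j, j'}" "j \<noteq> j'" by (meson card_2_iff)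
        have "\<not> (n j = 1 \<and> n j' = 1)"
          using no_two_singletons[of "kids i b" i b] j M4 by auto
        moreover have "kids i b \<noteq> {}" using j by simp
        then have "\<beta> i = int d + g \<or> \<not> one i \<and> \<beta> i = 2 * g" unfolding \<beta>_def by auto
        ultimately show ?thesis
          using ws[of j] ws[of j'] ones[of j] ones[of j'] g j by auto
      qed
    qed
    show "int k * \<beta> 0 < w 0"
    proof -
      have "(int k + 1) * (int (D + 2) - 1) - int d \<le> w 0" using M root by (intro w_mono) simp
      moreover have "(int k + 1) * (int (D + 2) - 1) = (int k + 1) * int D + int k + 1"
        by (simp add: algebra_simps)
      ultimately show ?thesis using kD by (simp add: \<beta>_def one_def)
    qed
    then show "int k * \<beta> i \<le> w i" if i: "i < L" "i \<notin> small" for i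
    proof (cases "i = 0")
      case False
      consider "one i" | "\<not> one i" "\<exists>b. kids i b \<noteq> {}" | "\<not> one i" "\<not> (\<exists>b. kids i b \<noteq> {})" by blast
      then show ?thesis
      proof cases
        case 1
        then obtain j where j: "j \<in> small" "par j = i" "n j = 1" using False unfolding one_def by blast
        then have "D + 1 \<le> n i" using par[of j] M unfolding small_def by simp
        then have "(int k + 1) * (int (D + 1) - 1) - int d \<le> w i" by (rule w_mono)
        then show ?thesis using 1 kD by (simp add: \<beta>_def)
      next
        case 2
        then obtain j where j: "j \<in> small" "par j = i" unfolding kids_def by blast
        then have "D \<le> n i" using par[of j] small2(1)[OF j(1)] M unfolding small_def by simp
        then have "(int k + 1) * (int D - 1) - int d \<le> w i" by (rule w_mono)
        \<comment> \<open>Only \<open>D\<close> vertices are now guaranteed for the predecessor,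
          which costs \<open>k + 1\<close> in weight; but the debt is smaller by
          \<open>k * (d - g) = k * (k + 1)\<close>, and \<open>k\<close> is positive.\<close>
        moreover have "int k * (2 * g) + (int k + 1) \<le> int k * (int d + g)"
        proof -
          have "1 * (int k + 1) \<le> int k * (int k + 1)"
            using small2(3)[OF j(1)] by (intro mult_right_mono) auto
          then show ?thesis by (simp add: g_def algebra_simps)
        qed
        moreover have "(int k + 1) * (int D - 1) = (int k + 1) * int D - (int k + 1)"
          by (simp add: algebra_simps)
        moreover have "int k * \<beta> i = int k * (2 * g)" using 2 by (simp add: \<beta>_def)
        ultimately show ?thesis using kD by linarith
      next
        case 3
        then show ?thesis using i False unfolding \<beta>_def small_def by simp
      qed
    qed simp
  qed
qed

end

section \<open>From extremal decompositions to the counting scheme\<close>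

context extremal
begin

text \<open>The size conditions are instances of \<open>no_cheap_arcs\<close>, with one arc or with
  the arcs of \<open>J\<close>; the density condition counts the edges on the listed components,
  which \<open>legal_complete\<close> makes closed under arcs.\<close>

lemma component_tree:
  assumes dens: "\<And>W. W \<subseteq> V \<Longrightarrow> W \<noteq> {} \<Longrightarrow>
    (d + k + 1) * card {e \<in> E. en e \<subseteq> W} + (k + 1) * (k + d) \<le> (k + 1) * (k + d) * card W"
  shows "\<exists>par pb. component_tree (\<lambda>j. card (comp F (ws ! j))) par pb (length ws) k d M"
proof -
  let ?L = "length ws" and ?n = "\<lambda>j. card (comp F (ws ! j))"
  have "\<exists>l b u e. l < j \<and> b < k \<and> conn F (ws ! l) u \<and> arc (T b) r u e (ws ! j)"
    if "0 < j" "j < ?L" for j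
    using legal_parentE[OF legal that] by metis
  then obtain par pb u a where pt: "\<And>j. 0 < j \<Longrightarrow> j < ?L \<Longrightarrow>
      par j < j \<and> pb j < k \<and> conn F (ws ! par j) (u j) \<and> arc (T (pb j)) r (u j) (a j) (ws ! j)"
    by metis
  have sep: "\<not> conn F (ws ! l) (ws ! j)" if "l < ?L" "j < ?L" "l \<noteq> j" for l j
  proof (cases "l < j")
    case False
    then have "\<not> conn F (ws ! j) (ws ! l)" using legalD(4)[OF legal, of l j] that by simp
    then show ?thesis using conn_sym by blast
  qed (use legalD(4)[OF legal] that in blast)
  show ?thesis
  proof (intro exI component_tree.intro)
    show "0 < ?L" using legalD(3)[OF legal] .
    show "?n 0 = M" using legalD(2)[OF legal] root_size by simp
    show "0 < ?n j" for j using card_comp_pos[OF forest_F] .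
    show "par j < j \<and> pb j < k \<and> M \<le> ?n (par j) + ?n j" if j: "0 < j" "j < ?L" for j
    proof (rule ccontr)
      have p: "par j < j" "pb j < k" "conn F (ws ! par j) (u j)" "arc (T (pb j)) r (u j) (a j) (ws ! j)"
        using pt[OF j] by auto
      assume "\<not> ?thesis"
      then have "?n (par j) + ?n j < M" using p(1,2) by simp
      then show False
        using p j sep[of _ j]
        by (intro no_cheap_arcs[of "par j" "pb j" "{a j}" 0 "\<lambda>_. u j" "\<lambda>_. ws ! j"])
          (auto simp: arc_def)
    qed
    show "\<exists>j\<in>J. c < ?n j" if J: "J \<subseteq> {j. 0 < j \<and> j < ?L \<and> par j = i \<and> pb j = b}"
      and c: "card J = Suc c" "0 < c" "c \<le> 2" "2 * c < M" for J i b c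
    proof (rule ccontr)
      assume "\<not> ?thesis"
      then have le: "?n j \<le> c" if "j \<in> J" for j using that by (simp add: not_less)
      have p: "i < j" "j < ?L" "b < k" "conn F (ws ! i) (u j)" "arc (T b) r (u j) (a j) (ws ! j)"
        if "j \<in> J" for j using pt[of j] J that by auto
      obtain j0 where j0: "j0 \<in> J" using c(1) by (metis card.empty ex_in_conv nat.distinct(1))
      have inj: "inj_on a J"
      proof (rule inj_onI)
        fix j j' assume j: "j \<in> J" "j' \<in> J" "a j = a j'"
        then have "ws ! j = ws ! j'"
          using arc_orient(2)[OF forest_T[OF p(3)[OF j(1)]] p(5)[OF j(1)]] p(5)[OF j(2)] by simp
        then show "j = j'" using sep[of j j'] p(2)[OF j(1)] p(2)[OF j(2)] conn_refl by metis
      qed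
      \<comment> \<open>\<open>no_cheap_arcs\<close> indexes tails and heads by arcs instead of list
        positions, so \<open>a\<close> is inverted.\<close>
      define h where "h = the_inv_into J a"
      have h: "h e \<in> J" "a (h e) = e" if "e \<in> a ` J" for e
        using that the_inv_into_into[OF inj that order_refl] f_the_inv_into_f[OF inj that]
        unfolding h_def by auto
      show False
      proof (rule no_cheap_arcs[of i b "a ` J" c "\<lambda>e. u (h e)" "\<lambda>e. ws ! h e"])
        show "i < ?L" "b < k" using p[OF j0] by auto
        show "a ` J \<subseteq> T b" using p(5) unfolding arc_def by blast
        show "card (a ` J) = Suc c" "c \<le> 2" using c inj by (simp_all add: card_image)
        show "arc (T b) r (u (h e)) e (ws ! h e)" "conn F (ws ! i) (u (h e))" if "e \<in> a ` J" for e
          using p(4,5)[OF h(1)[OF that]] h(2)[OF that] by simp_all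
        show "\<not> conn F (ws ! l) (ws ! h e)" if "e \<in> a ` J" "l \<le> i" for e l
          using p(1,2)[OF h(1)[OF that(1)]] that(2) by (intro sep) auto
        show "e = e'" if e: "e \<in> a ` J" "e' \<in> a ` J" "conn F (ws ! h e) (ws ! h e')" for e e'
        proof -
          have "h e = h e'"
            using sep[of "h e" "h e'"] e(3) p(2)[OF h(1)[OF e(1)]] p(2)[OF h(1)[OF e(2)]] by blast
          then show ?thesis using h(2)[OF e(1)] h(2)[OF e(2)] by metis
        qed
        show "c = 0 \<and> (\<forall>e\<in>a ` J. ?n i + card (comp F (ws ! h e)) < M)
            \<or> 0 < c \<and> 2 * c < M \<and> (\<forall>e\<in>a ` J. card (comp F (ws ! h e)) \<le> c)"
          using c(2,4) le h(1) by blast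
      qed
    qed
    let ?R = "\<Union>j<?L. comp F (ws ! j)"
    have RV: "?R \<subseteq> V" using red_comp_V[OF cfg legal_nth_in_V[OF cfg legal root_V]] by auto
    have finR: "finite ?R" using RV finite_V finite_subset by blast
    have rR: "r \<in> ?R" using legalD(2,3)[OF legal] by (metis UN_I conn_refl lessThan_iff mem_comp)
    have disj: "comp F (ws ! l) \<inter> comp F (ws ! j) = {}" if lj: "l < ?L" "j < ?L" "l \<noteq> j" for l j
    proof (rule ccontr)
      assume "comp F (ws ! l) \<inter> comp F (ws ! j) \<noteq> {}"
      then obtain z where "conn F (ws ! l) z" "conn F (ws ! j) z" by auto
      then have "conn F (ws ! l) (ws ! j)" by (meson conn_sym conn_trans)
      with sep[OF lj] show False ..
    qed
    have cardR: "card ?R = (\<Sum>j<?L. ?n j)"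
      using disj finite_comp[OF forest_F] by (intro card_UN_disjoint) auto
    define H where "H = {e \<in> E. en e \<subseteq> ?R}"
    have finE: "finite E"
    proof (rule finite_subset)
      show "E \<subseteq> F \<union> (\<Union>b<k. T b)"
      proof
        fix h assume h: "h \<in> E"
        show "h \<in> F \<union> (\<Union>b<k. T b)"
        proof (rule ccontr)
          assume "\<not> ?thesis"
          then have "mult T k h + of_bool (h \<in> F) = 0" unfolding mult_def by simp
          with cfgD(4)[OF cfg, of h] h show False by simp
        qed
      qed
      show "finite (F \<union> (\<Union>b<k. T b))" using forest_F forest_T forest_finite by auto
    qed
    then have finH: "finite H" by (simp add: H_def)
    have blue: "card ?R \<le> card (T b \<inter> H) + 1" if b: "b < k" for b
    proof -
      have "card ?R \<le> card {e \<in> T b. en e \<subseteq> ?R} + 1"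
      proof (rule card_edges_ge[OF forest_T[OF b] finR rR])
        fix z assume "z \<in> ?R"
        then obtain j where j: "j < ?L" "conn F (ws ! j) z" by auto
        have "Q (ws ! j) r"
        proof (cases "j = 0")
          case True
          then show ?thesis using legalD(2)[OF legal] equivp_reflp[OF equivp_Q] by simp
        next
          case False
          then have "pb j < k" "conn (T (pb j)) (ws ! j) r" using pt[of j] j(1) arc_conn by auto
          then show ?thesis using conn_T by simp
        qed
        moreover have "Q (ws ! j) z" using red_Q[OF cfg j(2)] .
        ultimately have "Q z r" using equivp_symp[OF equivp_Q] equivp_transp[OF equivp_Q] by blast
        then show "conn (T b) z r" using conn_T[OF b] by simp
      next
        fix z e z' assume "z \<in> ?R" and a: "arc (T b) r z e z'"
        then obtain j where "j < ?L" "conn F (ws ! j) z" by auto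
        from legal_complete[OF this b a] show "z' \<in> ?R" by auto
      qed
      also have "{e \<in> T b. en e \<subseteq> ?R} = T b \<inter> H" using cfgD(5)[OF cfg b] unfolding H_def by blast
      finally show ?thesis .
    qed
    have red: "(\<Sum>j<?L. ?n j) \<le> card (F \<inter> H) + ?L"
    proof -
      have "(\<Sum>j<?L. ?n j) \<le> (\<Sum>j<?L. card {e \<in> F. en e \<subseteq> comp F (ws ! j)} + 1)"
        using card_edges_comp_ge[OF forest_F] by (intro sum_mono) blast
      also have "\<dots> = (\<Sum>j<?L. card {e \<in> F. en e \<subseteq> comp F (ws ! j)}) + ?L"
        by (simp only: sum.distrib sum_constant card_lessThan mult_1_right of_nat_id)
      also have "(\<Sum>j<?L. card {e \<in> F. en e \<subseteq> comp F (ws ! j)})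
          = card (\<Union>j<?L. {e \<in> F. en e \<subseteq> comp F (ws ! j)})"
      proof (rule card_UN_disjoint[symmetric])
        show "\<forall>l\<in>{..<?L}. \<forall>j\<in>{..<?L}. l \<noteq> j \<longrightarrow>
            {e \<in> F. en e \<subseteq> comp F (ws ! l)} \<inter> {e \<in> F. en e \<subseteq> comp F (ws ! j)} = {}"
        proof (intro ballI impI)
          fix l j assume lj: "l \<in> {..<?L}" "j \<in> {..<?L}" "l \<noteq> j"
          have "False" if e: "e \<in> F" "en e \<subseteq> comp F (ws ! l)" "en e \<subseteq> comp F (ws ! j)" for e
          proof -
            obtain s t where "en e = {s, t}" using forest_endsE[OF forest_F e(1)] by blast
            with e(2,3) disj[of l j] lj show False by auto
          qed
          then show "{e \<in> F. en e \<subseteq> comp F (ws ! l)} \<inter> {e \<in> F. en e \<subseteq> comp F (ws ! j)} = {}"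
            by blast
        qed
      qed (use forest_finite[OF forest_F] in auto)
      also have "\<dots> \<le> card (F \<inter> H)"
        using finH cfgD(6)[OF cfg] unfolding H_def by (intro card_mono) auto
      finally show ?thesis by simp
    qed
    have "card H = (\<Sum>h\<in>H. mult T k h + of_bool (h \<in> F))"
      using cfgD(4)[OF cfg] by (simp add: H_def)
    also have "\<dots> = (\<Sum>h\<in>H. mult T k h) + card (F \<inter> H)"
      using finH by (simp add: sum.distrib of_bool_def sum.If_cases Int_commute)
    also have "(\<Sum>h\<in>H. mult T k h) = (\<Sum>b<k. card (T b \<inter> H))"
      by (rule sum_card_inter[OF finH, symmetric])
    finally have cH: "card H = (\<Sum>b<k. card (T b \<inter> H)) + card (F \<inter> H)" .
    have "k * card ?R = (\<Sum>b<k. card ?R)" by simp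
    also have "\<dots> \<le> (\<Sum>b<k. card (T b \<inter> H) + 1)" using blue by (intro sum_mono) simp
    also have "\<dots> = (\<Sum>b<k. card (T b \<inter> H)) + k"
      by (simp only: sum.distrib sum_constant card_lessThan mult_1_right of_nat_id)
    finally have kR: "k * card ?R \<le> (\<Sum>b<k. card (T b \<inter> H)) + k" .
    \<comment> \<open>Since \<open>(d + k + 1) * (k + 1) - (k + 1) * (k + d) = k + 1\<close>,
      combining this with the edge count leaves \<open>k + 1\<close> as the factor of
      \<open>card ?R\<close>.\<close>
    have "(d + k + 1) * card H + (k + 1) * (k + d) \<le> (k + 1) * (k + d) * card ?R"
      unfolding H_def using rR by (intro dens[OF RV]) blast
    moreover have "(d + k + 1) * (k * card ?R + card ?R) \<le> (d + k + 1) * (card H + k + ?L)"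
      using cH kR red cardR by (intro mult_left_mono) auto
    ultimately have "int ((d + k + 1) * (k * card ?R + card ?R) + (k + 1) * (k + d))
        \<le> int ((k + 1) * (k + d) * card ?R + (d + k + 1) * (k + ?L))"
      unfolding of_nat_le_iff by (simp add: algebra_simps)
    then have "(int k + 1) * (int (card ?R) - int ?L) - int d * int ?L \<le> - int d"
      by (simp add: algebra_simps)
    moreover have "(\<Sum>j<?L. (int k + 1) * (int (?n j) - 1) - int d)
        = (int k + 1) * (int (card ?R) - int ?L) - int d * int ?L"
      unfolding cardR by (simp add: sum_subtractf sum_distrib_left[symmetric])
    ultimately show "(\<Sum>j<?L. (int k + 1) * (int (?n j) - 1) - int d) \<le> - int d" by simp
  qed
qed

end

context tight_graph
begin

lemma extremal_exists:
  assumes cfg: "cfg T0 F0" and none: "\<And>T F. cfg T F \<Longrightarrow> \<not> bounded N F"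
  obtains M T F r ws where "N < M" "extremal en V E k Q M T F r ws"
proof -
  let ?ok = "\<lambda>M. \<exists>T F. cfg T F \<and> bounded M F"
  have ok: "?ok (card V)"
  proof (intro exI conjI)
    show "bounded (card V) F0" unfolding bounded_def
      using red_comp_V[OF cfg] finite_V by (auto intro: card_mono)
  qed (rule cfg)
  define M where "M = (LEAST M. ?ok M)"
  have okM: "?ok M" unfolding M_def using ok by (rule LeastI)
  have least: "\<not> ?ok M'" if "M' < M" for M' using not_less_Least[of M' ?ok] that unfolding M_def by blast
  have NM: "N < M"
  proof (rule ccontr)
    assume "\<not> N < M"
    then have "bounded M F \<Longrightarrow> bounded N F" for F unfolding bounded_def by (meson not_less order_trans)
    then show False using okM none by blast
  qed
  have "\<exists>p. cfg (fst p) (snd p) \<and> bounded M (snd p)" using okM by (simp add: split_paired_Ex)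
  then obtain p where p: "cfg (fst p) (snd p)" "bounded M (snd p)"
    and pmin: "\<And>q. cfg (fst q) (snd q) \<and> bounded M (snd q) \<Longrightarrow>
      card (big M (snd p)) \<le> card (big M (snd q))"
    using ex_has_least_nat[of "\<lambda>p. cfg (fst p) (snd p) \<and> bounded M (snd p)" _
        "\<lambda>p. card (big M (snd p))"] by blast
  obtain T1 F1 where p1: "p = (T1, F1)" by (cases p)
  have c1: "cfg T1 F1" "bounded M F1" using p p1 by auto
  have min1: "card (big M F1) \<le> card (big M F)" if "cfg T F" "bounded M F" for T F
    using pmin[of "(T, F)"] that p1 by simp
  have "big M F1 \<noteq> {}"
  proof
    assume e: "big M F1 = {}"
    \<comment> \<open>If no component had size \<open>M\<close>, then \<open>M - 1\<close> would be
      a bound as well; \<open>N < M\<close> makes it smaller than \<open>M\<close>.\<close>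
    have "bounded (M - 1) F1" unfolding bounded_def
    proof
      fix v assume v: "v \<in> V"
      then have "card (comp F1 v) \<noteq> M" using e unfolding big_def by blast
      moreover have "card (comp F1 v) \<le> M" using c1(2) v unfolding bounded_def by blast
      ultimately show "card (comp F1 v) \<le> M - 1" by linarith
    qed
    then show False using least[of "M - 1"] NM c1(1) by auto
  qed
  then obtain r where r: "r \<in> V" "card (comp F1 r) = M" unfolding big_def by blast
  \<comment> \<open>The root is fixed before the last minimisation, which therefore ranges only over
    forests in which its component has size \<open>M\<close>.\<close>
  define \<Q> where "\<Q> = (\<lambda>T F ws. cfg T F \<and> bounded M F \<and> card (big M F) = card (big M F1)
    \<and> card (comp F r) = M \<and> legal T k F r ws)"
  have "legal T1 k F1 r [r]" unfolding legal_def by auto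
  then have "\<Q> T1 F1 [r]" using c1 r unfolding \<Q>_def by blast
  then have "sizes M F1 [r] \<in> {sizes M F ws | T F ws. \<Q> T F ws}" by blast
  then obtain z where z: "z \<in> {sizes M F ws | T F ws. \<Q> T F ws}"
    and zmin: "\<And>y. (y, z) \<in> lex less_than \<Longrightarrow> y \<notin> {sizes M F ws | T F ws. \<Q> T F ws}"
    by (rule wfE_min[OF wf_lex[OF wf_less_than]]) blast
  then obtain T F ws where T: "z = sizes M F ws" "\<Q> T F ws" by blast
  have "extremal en V E k Q M T F r ws"
  proof
    show "(sizes M F' ws', sizes M F ws) \<notin> lex less_than"
      if "cfg T' F'" "bounded M F'" "card (big M F') = card (big M F)" "card (comp F' r) = M"
        "legal T' k F' r ws'" for T' F' ws'
    proof
      assume "(sizes M F' ws', sizes M F ws) \<in> lex less_than"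
      then have "sizes M F' ws' \<notin> {sizes M F ws | T F ws. \<Q> T F ws}" using zmin T(1) by blast
      moreover have "\<Q> T' F' ws'" using that T(2) unfolding \<Q>_def by simp
      ultimately show False by blast
    qed
    show "card (big M F) \<le> card (big M F')" if "cfg T' F'" "bounded M F'" for T' F'
      using min1[OF that] T(2) unfolding \<Q>_def by simp
  qed (use T(2) r(1) in \<open>auto simp: \<Q>_def\<close>)
  with NM that show thesis by blast
qed

end

section \<open>The decomposition\<close>

context edge_ends
begin

text \<open>The optimisation takes place on the edges \<open>E'\<close> inside the classes of
  \<open>X\<close>; the other edges belong to the first \<open>k\<close> forests and are put back at
  the end.\<close>

lemma decomposition:
  assumes finV: "finite V" and finE: "finite E" and E: "\<And>e. e \<in> E \<Longrightarrow> card (en e) = 2 \<and> en e \<subseteq> V"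
    and dens: "\<And>W. W \<subseteq> V \<Longrightarrow> W \<noteq> {} \<Longrightarrow>
      (d + k + 1) * card {e \<in> E. en e \<subseteq> W} + (k + 1) * (k + d) \<le> (k + 1) * (k + d) * card W"
    and D: "d \<le> k + 1 \<and> D = d \<or>
      k + 1 < d \<and> d \<le> 2 * (k + 1) \<and> (k + 1) * d + k * d \<le> (k + 1) * D + k * (k + 1)"
  obtains G where "\<And>b. b < k + 1 \<Longrightarrow> forest (G b)" "\<And>h. mult G (k + 1) h = of_bool (h \<in> E)"
    "\<And>v. v \<in> V \<Longrightarrow> card (comp (G k) v) \<le> D + 1"
proof -
  \<comment> \<open>As \<open>(k + 1) * (k + d) / (d + k + 1) \<le> k + 1\<close>, the hypothesis
    implies the condition of \<open>nash_williams\<close> for \<open>k + 1\<close> forests.\<close>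
  have "card {e \<in> E. en e \<subseteq> W} + (k + 1) \<le> (k + 1) * card W" if W: "W \<subseteq> V" "W \<noteq> {}" for W
  proof -
    have "(d + k + 1) * card {e \<in> E. en e \<subseteq> W} + (k + 1) * (k + d) \<le> (k + 1) * (k + d) * card W"
      using dens[OF W] .
    moreover have "1 \<le> card W" using W finV by (metis card_0_eq finite_subset less_one not_less)
    then have "(k + 1) * 1 \<le> (k + 1) * card W" by (rule mult_left_mono) simp
    ultimately have "(d + k + 1) * (card {e \<in> E. en e \<subseteq> W} + (k + 1)) \<le> (d + k + 1) * ((k + 1) * card W)"
      by (simp add: algebra_simps)
    then show ?thesis by (rule mult_left_le_imp_le) simp
  qed
  from tight_cover[OF finV finE E this]
  obtain T F X where T: "\<And>b. b < k \<Longrightarrow> forest (T b)" and F: "forest F"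
    and m: "\<And>h. mult T k h + of_bool (h \<in> F) = of_bool (h \<in> E)" and FX: "F \<subseteq> X"
    and TX: "\<And>b. b < k \<Longrightarrow> conn (T b \<inter> X) = conn X"
    by blast
  define E' where "E' = {e \<in> E. \<forall>u v. en e = {u, v} \<longrightarrow> conn X u v}"
  interpret tight_graph en V E' k "conn X"
  proof
    show "equivp (conn X)" by (rule equivp_conn)
  qed (use finV E in \<open>auto simp: E'_def\<close>)
  have TE: "T b \<subseteq> E" if b: "b < k" for b
  proof
    fix h assume "h \<in> T b"
    with mult_pos[of b k h T, OF b this] m[of h] show "h \<in> E" by (cases "h \<in> E") auto
  qed
  have FE: "F \<subseteq> E"
  proof
    fix h assume "h \<in> F"
    with m[of h] show "h \<in> E" by (cases "h \<in> E") auto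
  qed
  have XE: "h \<in> E'" if "h \<in> X" "h \<in> E" for h using that conn_edge[of h X] unfolding E'_def by blast
  have cT: "conn (T b \<inter> E') = conn X" if b: "b < k" for b
  proof (intro ext iffI)
    fix u v assume "conn (T b \<inter> E') u v"
    then show "conn X u v" by (rule conn_least[OF _ equivp_conn]) (auto simp: E'_def)
  next
    fix u v assume "conn X u v"
    then have "conn (T b \<inter> X) u v" using TX[OF b] by simp
    then show "conn (T b \<inter> E') u v" by (rule conn_mono) (use XE TE[OF b] in blast)
  qed
  have mE': "mult (\<lambda>b. T b \<inter> E') k h + of_bool (h \<in> F) = of_bool (h \<in> E')" for h
  proof (cases "h \<in> E'")
    case True
    then have "mult (\<lambda>b. T b \<inter> E') k h = mult T k h" unfolding mult_def by (intro sum.cong) auto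
    then show ?thesis using m[of h] True unfolding E'_def by simp
  next
    case False
    then have "h \<notin> F" using XE FX FE by blast
    with False show ?thesis unfolding mult_def by simp
  qed
  have cfg0: "cfg (\<lambda>b. T b \<inter> E') F"
    unfolding cfg_def using cT mE' F forest_subset[OF T] by blast
  have "\<exists>T F. cfg T F \<and> bounded (D + 1) F"
  proof (rule ccontr)
    assume "\<not> ?thesis"
    then have "\<And>T F. cfg T F \<Longrightarrow> \<not> bounded (D + 1) F" by blast
    then obtain M T F r ws where M: "D + 1 < M" and "extremal en V E' k (conn X) M T F r ws"
      using extremal_exists[OF cfg0] by blast
    then interpret ex: extremal en V E' k "conn X" M T F r ws by simp
    have "\<exists>par pb. component_tree (\<lambda>j. card (comp F (ws ! j))) par pb (length ws) k d M"
    proof (rule ex.component_tree)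
      fix W assume W: "W \<subseteq> V" "W \<noteq> {}"
      have "card {e \<in> E'. en e \<subseteq> W} \<le> card {e \<in> E. en e \<subseteq> W}"
        using finE by (intro card_mono) (auto simp: E'_def)
      then have "(d + k + 1) * card {e \<in> E'. en e \<subseteq> W} \<le> (d + k + 1) * card {e \<in> E. en e \<subseteq> W}"
        by (rule mult_left_mono) simp
      with dens[OF W]
      show "(d + k + 1) * card {e \<in> E'. en e \<subseteq> W} + (k + 1) * (k + d) \<le> (k + 1) * (k + d) * card W"
        by linarith
    qed
    then obtain par pb where
      ct: "component_tree (\<lambda>j. card (comp F (ws ! j))) par pb (length ws) k d M" by blast
    have "D + 2 \<le> M" using M by simp
    then show False
      using D component_tree.no_large_component_i[OF ct] component_tree.no_large_component_ii[OF ct]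
      by blast
  qed
  then obtain T' F' where cfg': "cfg T' F'" and bd: "bounded (D + 1) F'" by blast
  define G where "G = (\<lambda>b. if b < k then T' b \<union> (T b - E') else F')"
  have fG: "forest (G b)" if "b < k + 1" for b
  proof (cases "b < k")
    case True
    have "forest (T' b \<union> (T b - E'))"
    proof (rule forest_Un_cong[OF cfgD(1)[OF cfg' True], of "T b \<inter> E'"])
      show "conn (T b \<inter> E') = conn (T' b)" using cT[OF True] cfgD(2)[OF cfg' True] by simp
      show "finite (T b - E')" using forest_finite[OF T[OF True]] by simp
      have "T b \<inter> E' \<union> (T b - E') = T b" by blast
      then show "forest (T b \<inter> E' \<union> (T b - E'))" using T[OF True] by simp
    qed blast
    then show ?thesis using True by (simp add: G_def)
  qed (use cfgD(3)[OF cfg'] in \<open>simp add: G_def\<close>)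
  have mG: "mult G (k + 1) h = of_bool (h \<in> E)" for h
  proof -
    have eq: "mult G (k + 1) h = (\<Sum>b<k. of_bool (h \<in> T' b \<union> (T b - E'))) + of_bool (h \<in> F')"
      by (simp add: mult_def G_def)
    show ?thesis
    proof (cases "h \<in> E'")
      case True
      then have "(\<Sum>b<k. of_bool (h \<in> T' b \<union> (T b - E'))) = mult T' k h"
        unfolding mult_def by (intro sum.cong) auto
      with eq have "mult G (k + 1) h = mult T' k h + of_bool (h \<in> F')" by simp
      also have "\<dots> = of_bool (h \<in> E')" by (rule cfgD(4)[OF cfg'])
      finally show ?thesis using True by (simp add: E'_def)
    next
      case False
      then have n: "h \<notin> F'" "\<And>b. b < k \<Longrightarrow> h \<notin> T' b" "h \<notin> F"
        using cfgD(5,6)[OF cfg'] cfgD(6)[OF cfg0] by blast+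
      have "(\<Sum>b<k. of_bool (h \<in> T' b \<union> (T b - E'))) = mult T k h"
        unfolding mult_def using n(2) False by (intro sum.cong) auto
      with eq have "mult G (k + 1) h = mult T k h" using n(1) by simp
      then show ?thesis using m[of h] n(3) by simp
    qed
  qed
  show thesis
  proof (rule that[OF fG mG])
    show "card (comp (G k) v) \<le> D + 1" if "v \<in> V" for v
      using bd that unfolding bounded_def G_def by simp
  qed
qed

end

section \<open>Return to multigraphs\<close>

context loopfree_multigraph
begin

interpretation edge_ends "ends G" .

text \<open>\<open>k + d / (d + k + 1) = (k + 1) * (k + d) / (d + k + 1)\<close>, and the
  denominators are cleared. A single vertex gives no arboricity ratio; there the inequality holds
  because loops are excluded.\<close>

lemma density:
  assumes \<Gamma>: "fractional_arboricity G \<le> real k + real d / (real d + real k + 1)"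
    and W: "W \<subseteq> verts G" "W \<noteq> {}"
  shows "(d + k + 1) * card {e \<in> edges G. ends G e \<subseteq> W} + (k + 1) * (k + d)
    \<le> (k + 1) * (k + d) * card W"
proof -
  let ?EW = "{e \<in> edges G. ends G e \<subseteq> W}"
  have finW: "finite W" using W(1) finite_verts finite_subset by blast
  have "card W \<noteq> 0" using finW W(2) by simp
  then consider "card W = 1" | "2 \<le> card W" by linarith
  then show ?thesis
  proof cases
    case 1
    have no_edge: "?EW = {}"
    proof (rule ccontr)
      assume "?EW \<noteq> {}"
      then obtain e where "e \<in> edges G" "ends G e \<subseteq> W" by blast
      then show False using no_loops[of e] card_mono[OF finW, of "ends G e"] 1 by simp
    qed
    show ?thesis unfolding no_edge using 1 by simp
  next
    case 2
    let ?H = "\<lparr>verts = W, edges = ?EW, ends = ends G\<rparr>"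
    have "subgraph ?H G"
      unfolding subgraph_def loopfree_multigraph_def
      using finW W(1) finite_edges no_loops by auto
    then have "real (card ?EW) / (real (card W) - 1) \<in> arboricity_ratios G"
      unfolding arboricity_ratios_def using 2 by force
    then have "real (card ?EW) / (real (card W) - 1) \<le> Max (arboricity_ratios G)"
      using finite_arboricity_ratios[OF loopfree_multigraph_axioms] by (intro Max_ge)
    also have "\<dots> = fractional_arboricity G"
      using 2 card_mono[OF finite_verts W(1)] unfolding fractional_arboricity_def by simp
    also note \<Gamma>
    also have "real k + real d / (real d + real k + 1) = (k + 1) * (k + d) / real (d + k + 1)"
      by (simp add: field_simps)
    finally have "card ?EW * real (d + k + 1) \<le> (k + 1) * (k + d) * (real (card W) - 1)"
      using 2 by (simp add: divide_simps mult.commute)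
    then have "real ((d + k + 1) * card ?EW + (k + 1) * (k + d)) \<le> real ((k + 1) * (k + d) * card W)"
      by (simp add: algebra_simps)
    then show ?thesis unfolding of_nat_le_iff .
  qed
qed

text \<open>The other edges of a cycle join the ends of its last edge, which then is no
  bridge.\<close>

lemma forest_acyclic:
  assumes S: "forest S"
  shows "acyclic_graph (edge_induced G S)"
  unfolding acyclic_graph_def
proof
  assume "\<exists>vs es. is_cycle (edge_induced G S) vs es"
  then obtain vs es where c: "vs \<noteq> []" "length es = length vs" "distinct es" "set es \<subseteq> S"
    "\<And>i. i < length es \<Longrightarrow> ends G (es ! i) = {vs ! i, vs ! (Suc i mod length vs)}"
    unfolding is_cycle_def edge_induced_def by auto
  define l where "l = length vs - 1"
  have l: "l < length es" "Suc l = length vs" using c(1,2) by (auto simp: l_def)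
  have "conn (S - {es ! l}) (vs ! 0) (vs ! i)" if "i \<le> l" for i
    using that
  proof (induction i)
    case (Suc i)
    have "es ! i \<noteq> es ! l" using Suc.prems l(1) c(3) by (simp add: nth_eq_iff_index_eq)
    moreover have "es ! i \<in> S" using Suc.prems l(1) c(4) by (simp add: subset_iff)
    moreover have "ends G (es ! i) = {vs ! i, vs ! Suc i}"
      using c(5)[of i] Suc.prems l by simp
    ultimately have "conn (S - {es ! l}) (vs ! i) (vs ! Suc i)" by (intro conn_edge[of "es ! i"]) auto
    with Suc show ?case using conn_trans by simp
  qed simp
  then have "conn (S - {es ! l}) (vs ! l) (vs ! 0)" using conn_sym by simp
  moreover have "es ! l \<in> S" using l(1) c(4) by (simp add: subset_iff)
  moreover have "ends G (es ! l) = {vs ! l, vs ! 0}" using c(5)[OF l(1)] l(2) by simp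
  ultimately show False using forest_bridge[OF S] by blast
qed

lemma card_edges_component:
  assumes S: "forest S" and C: "C \<in> components (edge_induced G S)"
  obtains v where "v \<in> (\<Union>e\<in>S. ends G e)" "card (edges C) + 1 \<le> card (comp S v)"
proof -
  let ?H = "edge_induced G S"
  obtain v where v: "v \<in> verts ?H" "C = component_of ?H v" using C unfolding components_def by blast
  have "conn S v w" if "(v, w) \<in> (adjacency ?H)\<^sup>*" for w
    using that
  proof (induction rule: rtrancl_induct)
    case (step u w)
    then have "conn S u w" unfolding adjacency_def edge_induced_def using conn_edge by auto
    with step.IH show ?case by (rule conn_trans)
  qed simp
  then have "edges C \<subseteq> {e \<in> S. ends G e \<subseteq> comp S v}"
    unfolding v(2) component_of_def edge_induced_def by auto
  then have "card (edges C) \<le> card {e \<in> S. ends G e \<subseteq> comp S v}"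
    using forest_finite[OF S] by (intro card_mono) auto
  also have "\<dots> + 1 \<le> card (comp S v)" by (rule card_edges_comp_le[OF S])
  finally show thesis using that v(1) unfolding edge_induced_def by simp
qed

lemma forest_partition_bounded:
  assumes \<Gamma>: "fractional_arboricity G \<le> real k + real d / (real d + real k + 1)"
    and D: "d \<le> k + 1 \<and> D = d \<or>
      k + 1 < d \<and> d \<le> 2 * (k + 1) \<and> (k + 1) * d + k * d \<le> (k + 1) * D + k * (k + 1)"
  shows "\<exists>F. forest_partition G (k + 1) F \<and>
    (\<exists>i<k + 1. \<forall>C\<in>components (edge_induced G (F i)). card (edges C) \<le> D)"
proof -
  obtain F where F: "\<And>b. b < k + 1 \<Longrightarrow> forest (F b)" "\<And>h. mult F (k + 1) h = of_bool (h \<in> edges G)"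
    "\<And>v. v \<in> verts G \<Longrightarrow> card (comp (F k) v) \<le> D + 1"
    using decomposition[OF finite_verts finite_edges _ density[OF \<Gamma>] D] no_loops ends_subset by blast
  have sub: "F b \<subseteq> edges G" if b: "b < k + 1" for b
  proof
    fix h assume "h \<in> F b"
    with mult_pos[of b "k + 1" h F, OF b this] F(2)[of h] show "h \<in> edges G"
      by (cases "h \<in> edges G") auto
  qed
  have "forest_partition G (k + 1) F"
    unfolding forest_partition_def
  proof (intro conjI allI impI)
    show "(\<Union>i<k + 1. F i) = edges G"
    proof
      show "edges G \<subseteq> (\<Union>i<k + 1. F i)"
      proof (rule ccontr)
        assume "\<not> ?thesis"
        then obtain h where h: "h \<in> edges G" "\<And>i. i < k + 1 \<Longrightarrow> h \<notin> F i" by blast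
        then have "mult F (k + 1) h = 0" unfolding mult_def by simp
        then show False using F(2)[of h] h(1) by simp
      qed
    qed (use sub in blast)
    show "F i \<inter> F j = {}" if ij: "i < k + 1" "j < k + 1" "i \<noteq> j" for i j
    proof (rule ccontr)
      assume "F i \<inter> F j \<noteq> {}"
      then obtain h where h: "h \<in> F i" "h \<in> F j" by blast
      have "(\<Sum>b\<in>{i, j}. of_bool (h \<in> F b)) \<le> mult F (k + 1) h"
        unfolding mult_def using ij by (intro sum_mono2) auto
      then show False using h ij(3) F(2)[of h] by (cases "h \<in> edges G") auto
    qed
    show "acyclic_graph (edge_induced G (F i))" if "i < k + 1" for i
      using forest_acyclic[OF F(1)[OF that]] .
  qed
  moreover have "card (edges C) \<le> D" if C: "C \<in> components (edge_induced G (F k))" for C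
  proof -
    have "forest (F k)" using F(1) by simp
    from card_edges_component[OF this C]
    obtain v where v: "v \<in> (\<Union>e\<in>F k. ends G e)" "card (edges C) + 1 \<le> card (comp (F k) v)" .
    then have "v \<in> verts G" using sub[of k] ends_subset by auto
    then show ?thesis using F(3) v(2) by fastforce
  qed
  ultimately show ?thesis by (intro exI[of _ F] conjI exI[of _ k]) auto
qed

end

theorem theorem1p4:
  fixes G :: "('v, 'e) multigraph" and k d :: nat
  assumes "loopfree_multigraph G"
    and "fractional_arboricity G \<le> real k + real d / (real d + real k + 1)"
  shows
    "(d \<le> k + 1 \<longrightarrow>
       (\<exists>F. forest_partition G (k + 1) F \<and>
         (\<exists>i<k + 1. \<forall>C\<in>components (edge_induced G (F i)). card (edges C) \<le> d)))
     \<and>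
     (k + 1 < d \<and> d \<le> 2 * (k + 1) \<longrightarrow>
       (\<exists>F. forest_partition G (k + 1) F \<and>
         (\<exists>i<k + 1. \<forall>C\<in>components (edge_induced G (F i)).
           int (card (edges C)) \<le> int d + \<lceil>real k * (real d / (real k + 1))\<rceil> - int k)))"
proof (intro conjI impI)
  interpret loopfree_multigraph G by fact
  show "\<exists>F. forest_partition G (k + 1) F \<and>
      (\<exists>i<k + 1. \<forall>C\<in>components (edge_induced G (F i)). card (edges C) \<le> d)" if "d \<le> k + 1"
    using forest_partition_bounded[OF assms(2)] that by blast
  assume d: "k + 1 < d \<and> d \<le> 2 * (k + 1)"
  let ?c = "\<lceil>real k * (real d / (real k + 1))\<rceil>"
  \<comment> \<open>The ceiling is nonnegative and \<open>d > k + 1\<close>, so \<open>nat\<close>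
    truncates nothing.\<close>
  define D where "D = nat (int d + ?c - int k)"
  have c0: "0 \<le> ?c" by (simp add: order_less_le_trans[of "-1" 0])
  then have D: "int D = int d + ?c - int k" using d unfolding D_def by linarith
  have "(real k + 1) * (real k * (real d / (real k + 1))) \<le> (real k + 1) * of_int ?c"
    by (intro mult_left_mono le_of_int_ceiling) simp
  then have "of_int (int k * int d) \<le> (of_int ((int k + 1) * ?c) :: real)" by simp
  then have "int k * int d \<le> (int k + 1) * ?c" unfolding of_int_le_iff .
  then have "int k * int d \<le> (int k + 1) * (int D - int d + int k)" using D by simp
  then have "int ((k + 1) * d + k * d) \<le> int ((k + 1) * D + k * (k + 1))" by (simp add: algebra_simps)
  then have "(k + 1) * d + k * d \<le> (k + 1) * D + k * (k + 1)" unfolding of_nat_le_iff .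
  with d have "\<exists>F. forest_partition G (k + 1) F \<and>
      (\<exists>i<k + 1. \<forall>C\<in>components (edge_induced G (F i)). card (edges C) \<le> D)"
    by (intro forest_partition_bounded[OF assms(2)]) blast
  then show "\<exists>F. forest_partition G (k + 1) F \<and>
      (\<exists>i<k + 1. \<forall>C\<in>components (edge_induced G (F i)).
        int (card (edges C)) \<le> int d + ?c - int k)"
    unfolding D[symmetric] of_nat_le_iff .
qed

end
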